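(* Let $\mu_0,\dots,\mu_{J-1}$ be $J$ finite Gaussian mixtures on $\mathbb{R}^d$, written $\mu_j=\sum_{k=1}^{K_j}\pi_j^k\mu_j^k$ with $\mu_j^k$ Gaussian, $\pi_j^k\ge0$ and $\sum_k\pi_j^k=1$, and let $\lambda_0,\dots,\lambda_{J-1}$ be positive weights summing to $1$. The optimization problem defining $MMW_2^2(\mu_0,\dots,\mu_{J-1})$ can be rewritten under the discrete form $$MMW_2^2(\mu_0,\dots,\mu_{J-1})=\min_{w \in \Pi(\pi_0,\dots,\pi_{J-1})}\ \sum_{k_0,\dots,k_{J-1}=1}^{K_0,\dots,K_{J-1}} w_{k_0\dots k_{J-1}}\; mmW_2^2(\mu_0^{k_0},\dots,\mu_{J-1}^{k_{J-1}}).$$ Moreover, the solution $\gamma^*$ of the problem defining $MMW_2^2(\mu_0,\dots,\mu_{J-1})$ can be written $$\gamma^*=\sum_{\substack{1\le k_0\le K_0\\ \dots\\ 1\le k_{J-1}\le K_{J-1}}} w^*_{k_0k_1\dots k_{J-1}}\,\gamma^*_{k_0k_1\dots k_{J-1}},$$ where $w^*$ is solution of the discrete problem above and $\gamma^*_{k_0k_1\dots k_{J-1}}$ is the optimal multi-marginal plan between the Gaussian measures $\mu_0^{k_0},\dots,\mu_{J-1}^{k_{J-1}}$.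
   Context: $d\ge1$ and $J\ge2$ are integers. $GMM_n(\infty)$ is the set of finite Gaussian mixtures on $\mathbb{R}^n$, i.e. finite convex combinations of (possibly degenerate) Gaussian distributions. $\Pi(\mu_0,\dots,\mu_{J-1})$ is the set of probability measures on $(\mathbb{R}^d)^J\cong\mathbb{R}^{Jd}$ with marginals $\mu_0,\dots,\mu_{J-1}$. With the weights $\lambda_j$ fixed, let $$c(x_0,\dots,x_{J-1})=\sum_{i=0}^{J-1}\lambda_i\|x_i-B(x)\|^2=\tfrac12\sum_{i,j=0}^{J-1}\lambda_i\lambda_j\|x_i-x_j\|^2,\qquad B(x)=\sum_{i=0}^{J-1}\lambda_i x_i .$$ The (unrestricted) multi-marginal problem is $mmW_2^2(\mu_0,\dots,\mu_{J-1})=\inf_{\gamma\in\Pi(\mu_0,\dots,\mu_{J-1})}\int c\,d\gamma$; an optimal multi-marginal plan is a $\gamma$ attaining this infimum. The multi-marginal problem restricted to Gaussian mixtures is $$MMW_2^2(\mu_0,\dots,\mu_{J-1})=\inf_{\gamma\in\Pi(\mu_0,\dots,\mu_{J-1})\cap GMM_{Jd}(\infty)}\int_{(\mathbb{R}^d)^J} c\,d\gamma .$$ $\Pi(\pi_0,\dots,\pi_{J-1})$ is the set of $K_0\times\dots\times K_{J-1}$ tensors $w$ with nonnegative entries such that for every $j\in\{0,\dots,J-1\}$ and every $k\in\{1,\dots,K_j\}$, the sum of $w_{k_0\dots k_{J-1}}$ over all indices with $k_j=k$ equals $\pi_j^k$. *)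

theory Defs
  imports "HOL-Probability.Probability"
begin

definition normal_law :: "real \<Rightarrow> real \<Rightarrow> real measure" where
  "normal_law m \<sigma> = (if \<sigma> = 0 then return borel m else density lborel (normal_density m \<sigma>))"

text \<open>A possibly degenerate Gaussian: every linear functional has a normal law,
  a point mass being allowed. This forces \<^term>\<open>M\<close> to be a probability measure.\<close>

definition gaussian_measure :: "'a::euclidean_space measure \<Rightarrow> bool" where
  "gaussian_measure M \<longleftrightarrow> sets M = sets borel \<and>
    (\<forall>t. \<exists>m \<sigma>. \<sigma> \<ge> 0 \<and> distr M borel (\<lambda>x. t \<bullet> x) = normal_law m \<sigma>)"

definition mixture ::
    "'i set \<Rightarrow> ('i \<Rightarrow> real) \<Rightarrow> ('i \<Rightarrow> 'a::euclidean_space measure) \<Rightarrow> 'a measure" where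
  "mixture I w \<nu> =
    measure_of UNIV (sets borel) (\<lambda>A. \<Sum>i\<in>I. ennreal (w i) * emeasure (\<nu> i) A)"

lemma sets_mixture [simp]: "sets (mixture I w \<nu>) = sets borel"
  unfolding mixture_def using sets.sigma_sets_eq[of borel] by simp

lemma emeasure_mixture:
  assumes "\<And>i. i \<in> I \<Longrightarrow> sets (\<nu> i) = sets borel" and "A \<in> sets borel"
  shows "emeasure (mixture I w \<nu>) A = (\<Sum>i\<in>I. ennreal (w i) * emeasure (\<nu> i) A)"
proof (rule emeasure_measure_of[OF mixture_def])
  show "countably_additive (sets (mixture I w \<nu>))
      (\<lambda>A. \<Sum>i\<in>I. ennreal (w i) * emeasure (\<nu> i) A)"
    unfolding countably_additive_def
  proof (intro allI impI)
    fix A :: "nat \<Rightarrow> 'b set"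
    assume A: "range A \<subseteq> sets (mixture I w \<nu>)" "disjoint_family A"
    have "(\<Sum>n. \<Sum>i\<in>I. ennreal (w i) * emeasure (\<nu> i) (A n))
        = (\<Sum>i\<in>I. \<Sum>n. ennreal (w i) * emeasure (\<nu> i) (A n))"
      by (rule suminf_sum) simp
    also have "\<dots> = (\<Sum>i\<in>I. ennreal (w i) * emeasure (\<nu> i) (\<Union>n. A n))"
      using A assms(1) by (intro sum.cong refl) (simp add: suminf_emeasure)
    finally show "(\<Sum>n. \<Sum>i\<in>I. ennreal (w i) * emeasure (\<nu> i) (A n))
        = (\<Sum>i\<in>I. ennreal (w i) * emeasure (\<nu> i) (\<Union>n. A n))" .
  qed
qed (use assms in \<open>auto simp: positive_def\<close>)

definition GMM :: "'a::euclidean_space measure set" where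
  "GMM = {M. \<exists>(K::nat) p \<nu>. (\<forall>k\<in>{1..K}. p k \<ge> 0 \<and> gaussian_measure (\<nu> k)) \<and>
      (\<Sum>k=1..K. p k) = 1 \<and> M = mixture {1..K} p \<nu>}"

definition couplings ::
    "('j::finite \<Rightarrow> 'a::euclidean_space measure) \<Rightarrow> ('a ^ 'j) measure set" where
  "couplings \<mu> = {\<gamma>. prob_space \<gamma> \<and> sets \<gamma> = sets borel \<and>
      (\<forall>j. distr \<gamma> borel (\<lambda>x. x $ j) = \<mu> j)}"

definition barycenter :: "('j::finite \<Rightarrow> real) \<Rightarrow> 'a::euclidean_space ^ 'j \<Rightarrow> 'a" where
  "barycenter lam x = (\<Sum>i\<in>UNIV. lam i *\<^sub>R x $ i)"

definition mm_cost :: "('j::finite \<Rightarrow> real) \<Rightarrow> 'a::euclidean_space ^ 'j \<Rightarrow> real" where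
  "mm_cost lam x = (\<Sum>i\<in>UNIV. lam i * (norm (x $ i - barycenter lam x))\<^sup>2)"

lemma mm_cost_eq_pairwise:
  assumes "(\<Sum>i\<in>UNIV. lam i) = 1"
  shows "mm_cost lam x =
    (1/2) * (\<Sum>i\<in>UNIV. \<Sum>j\<in>UNIV. lam i * lam j * (norm (x $ i - x $ j))\<^sup>2)"
proof -
  let ?B = "barycenter lam x"
  let ?q = "\<Sum>i\<in>UNIV. lam i * (x $ i \<bullet> x $ i)"
  have *: "(\<Sum>i\<in>UNIV. lam i * (x $ i \<bullet> v)) = ?B \<bullet> v" for v
    by (simp add: barycenter_def inner_sum_left)
  have **: "(\<Sum>i\<in>UNIV. lam i * (v \<bullet> x $ i)) = ?B \<bullet> v" for v
    using *[of v] by (simp add: inner_commute)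
  have "mm_cost lam x = (\<Sum>i\<in>UNIV. lam i * (x $ i \<bullet> x $ i)
      - 2 * (lam i * (x $ i \<bullet> ?B)) + lam i * (?B \<bullet> ?B))"
    unfolding mm_cost_def
    by (simp add: power2_norm_eq_inner inner_diff inner_commute algebra_simps)
  also have "\<dots> = ?q - 2 * (?B \<bullet> ?B) + ?B \<bullet> ?B"
    by (simp add: sum.distrib sum_subtractf * assms flip: sum_distrib_left sum_distrib_right)
  finally have L: "mm_cost lam x = ?q - ?B \<bullet> ?B" by simp
  have "(\<Sum>j\<in>UNIV. lam i * lam j * (norm (x $ i - x $ j))\<^sup>2)
      = lam i * (x $ i \<bullet> x $ i) - 2 * (lam i * (x $ i \<bullet> ?B)) + lam i * ?q" for i
  proof -
    have "(\<Sum>j\<in>UNIV. lam i * lam j * (norm (x $ i - x $ j))\<^sup>2)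
      = (\<Sum>j\<in>UNIV. lam j * (lam i * (x $ i \<bullet> x $ i))
         - 2 * lam i * (lam j * (x $ i \<bullet> x $ j)) + lam i * (lam j * (x $ j \<bullet> x $ j)))"
      by (simp add: power2_norm_eq_inner inner_diff inner_commute algebra_simps)
    also have "\<dots> = lam i * (x $ i \<bullet> x $ i) - 2 * (lam i * (x $ i \<bullet> ?B)) + lam i * ?q"
      by (simp add: sum.distrib sum_subtractf * ** assms inner_commute
          flip: sum_distrib_left sum_distrib_right)
    finally show ?thesis .
  qed
  then have "(\<Sum>i\<in>UNIV. \<Sum>j\<in>UNIV. lam i * lam j * (norm (x $ i - x $ j))\<^sup>2)
      = ?q - 2 * (?B \<bullet> ?B) + ?q"
    by (simp add: sum.distrib sum_subtractf * assms flip: sum_distrib_left sum_distrib_right)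
  with L show ?thesis by simp
qed

definition plan_cost ::
    "('j::finite \<Rightarrow> real) \<Rightarrow> ('a::euclidean_space ^ 'j) measure \<Rightarrow> ennreal" where
  "plan_cost lam \<gamma> = (\<integral>\<^sup>+x. ennreal (mm_cost lam x) \<partial>\<gamma>)"

definition mmW2_sq ::
    "('j::finite \<Rightarrow> real) \<Rightarrow> ('j \<Rightarrow> 'a::euclidean_space measure) \<Rightarrow> ennreal" where
  "mmW2_sq lam \<mu> = (INF \<gamma>\<in>couplings \<mu>. plan_cost lam \<gamma>)"

definition optimal_mm_plan ::
    "('j::finite \<Rightarrow> real) \<Rightarrow> ('j \<Rightarrow> 'a::euclidean_space measure) \<Rightarrow> ('a ^ 'j) measure \<Rightarrow> bool" where
  "optimal_mm_plan lam \<mu> \<gamma> \<longleftrightarrow> \<gamma> \<in> couplings \<mu> \<and> plan_cost lam \<gamma> = mmW2_sq lam \<mu>"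

definition MMW2_sq ::
    "('j::finite \<Rightarrow> real) \<Rightarrow> ('j \<Rightarrow> 'a::euclidean_space measure) \<Rightarrow> ennreal" where
  "MMW2_sq lam \<mu> = (INF \<gamma>\<in>couplings \<mu> \<inter> GMM. plan_cost lam \<gamma>)"

definition optimal_GMM_plan ::
    "('j::finite \<Rightarrow> real) \<Rightarrow> ('j \<Rightarrow> 'a::euclidean_space measure) \<Rightarrow> ('a ^ 'j) measure \<Rightarrow> bool" where
  "optimal_GMM_plan lam \<mu> \<gamma> \<longleftrightarrow>
    \<gamma> \<in> couplings \<mu> \<inter> GMM \<and> plan_cost lam \<gamma> = MMW2_sq lam \<mu>"

definition multi_indices :: "('j \<Rightarrow> nat) \<Rightarrow> ('j \<Rightarrow> nat) set" where
  "multi_indices K = (\<Pi>\<^sub>E j\<in>UNIV. {1..K j})"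

text \<open>Tensors are functions on all multi-indices; values outside
  \<^term>\<open>multi_indices K\<close> are irrelevant.\<close>

definition discrete_couplings ::
    "('j::finite \<Rightarrow> nat) \<Rightarrow> ('j \<Rightarrow> nat \<Rightarrow> real) \<Rightarrow> (('j \<Rightarrow> nat) \<Rightarrow> real) set" where
  "discrete_couplings K p = {w. (\<forall>k\<in>multi_indices K. w k \<ge> 0) \<and>
      (\<forall>j. \<forall>l\<in>{1..K j}. (\<Sum>k | k \<in> multi_indices K \<and> k j = l. w k) = p j l)}"

definition discrete_cost ::
    "('j::finite \<Rightarrow> real) \<Rightarrow> ('j \<Rightarrow> nat) \<Rightarrow> ('j \<Rightarrow> nat \<Rightarrow> 'a::euclidean_space measure) \<Rightarrow>
      (('j \<Rightarrow> nat) \<Rightarrow> real) \<Rightarrow> ennreal" where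
  "discrete_cost lam K \<nu> w =
    (\<Sum>k\<in>multi_indices K. ennreal (w k) * mmW2_sq lam (\<lambda>j. \<nu> j (k j)))"

definition discrete_solution ::
    "('j::finite \<Rightarrow> real) \<Rightarrow> ('j \<Rightarrow> nat) \<Rightarrow> ('j \<Rightarrow> nat \<Rightarrow> real) \<Rightarrow>
      ('j \<Rightarrow> nat \<Rightarrow> 'a::euclidean_space measure) \<Rightarrow> (('j \<Rightarrow> nat) \<Rightarrow> real) \<Rightarrow> bool" where
  "discrete_solution lam K p \<nu> w \<longleftrightarrow>
    is_arg_min (discrete_cost lam K \<nu>) (\<lambda>w. w \<in> discrete_couplings K p) w"

end

theory Submission
  imports Defs "HOL-Real_Asymp.Real_Asymp"
begin

text \<open>
  Two facts about Gaussian measures carry the proof: the family of finite Gaussian mixtures is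
  identifiable, and between Gaussian marginals some optimal multi-marginal plan is itself Gaussian.

  Given the second fact, every admissible tensor \<open>w\<close> yields a competitor for the restricted
  problem: mix Gaussian optimal plans between the components with the weights \<open>w\<close>. The result is
  a Gaussian mixture with the right marginals, and its cost is the discrete cost of \<open>w\<close>. So the
  restricted infimum is at most the discrete minimum.

  Given the first fact, a coupling \<open>\<gamma>\<close> that is a Gaussian mixture with components \<open>N\<^sub>m\<close> has
  marginals of the \<open>N\<^sub>m\<close> that are all found among the components of the \<open>\<mu>\<^sub>j\<close>. Splitting the
  mass of each \<open>N\<^sub>m\<close> over the indices of these components turns \<open>\<gamma>\<close> into a mixture over
  multi-indices \<open>k\<close>, in which the piece of index \<open>k\<close> couples the component Gaussians that \<open>k\<close>
  selects and the weights form an admissible tensor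
  (\<open>GMM_coupling_decomposition\<close>). The cost is affine in the measure, so it is at least the
  discrete cost of these weights. If \<open>\<gamma>\<close> is optimal then all inequalities are equalities: the
  weights solve the discrete problem, and each piece of positive weight is an optimal plan. A piece
  of weight zero may be replaced by any optimal plan, which is where existence of such plans is
  used a second time.

  Identifiability (\<open>gaussian_mixture_identifiable\<close>) is reduced to dimension one. A Gaussian is
  determined by its one-dimensional images (\<open>Cramer_Wold\<close>), so for finitely many distinct
  Gaussians some direction \<open>t\<close> separates all their images (\<open>separating_direction\<close>). Along \<open>t\<close>
  the Laplace transforms are exponentials of distinct quadratic polynomials, which are linearly
  independent because their growth rates at infinity differ.

  For the Gaussian optimal plan (\<open>optimal_gaussian_plan_exists\<close>), the cost is quadratic, so the
  cost of a coupling depends only on its mean, which the marginals prescribe, and affinely on its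
  covariance form. The forms that have the prescribed diagonal blocks are a compact set, on which
  the cost attains its minimum, and each of them is the covariance of a Gaussian coupling.
\<close>

section \<open>Mixtures of measures\<close>

lemma space_mixture [simp]: "space (mixture I w \<nu>) = UNIV"
  using sets_eq_imp_space_eq[OF sets_mixture[of I w \<nu>]] by simp

lemma nn_integral_mixture:
  fixes \<nu> :: "'i \<Rightarrow> 'a::euclidean_space measure"
  assumes fin: "finite I" and s: "\<And>i. i \<in> I \<Longrightarrow> sets (\<nu> i) = sets borel"
    and f: "f \<in> borel_measurable borel"
  shows "(\<integral>\<^sup>+x. f x \<partial>mixture I w \<nu>) = (\<Sum>i\<in>I. ennreal (w i) * (\<integral>\<^sup>+x. f x \<partial>\<nu> i))"
proof -
  have f': "f \<in> borel_measurable (mixture I w \<nu>)"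
    using f by (simp add: measurable_def)
  have m: "g \<in> borel_measurable (\<nu> i)" if "i \<in> I" "g \<in> borel_measurable (mixture I w \<nu>)"
    for i and g :: "'a \<Rightarrow> ennreal"
  proof -
    have "sets (\<nu> i) = sets (mixture I w \<nu>)" using s[OF that(1)] by simp
    then show ?thesis using that(2) by (simp cong: measurable_cong_sets)
  qed
  have sp: "space (\<nu> i) = UNIV" if "i \<in> I" for i
    using sets_eq_imp_space_eq[OF s[OF that]] by simp
  show ?thesis
    using f'
  proof (induction rule: borel_measurable_induct)
    case (cong f g)
    then have "f = g" by auto
    then show ?case using cong by simp
  next
    case (set A)
    then show ?case using s
      by (simp add: emeasure_mixture)
  next
    case (mult u c)
    then show ?case
      by (simp add: nn_integral_cmult m sum_distrib_left mult.left_commute)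
  next
    case (add u v)
    then show ?case
      by (simp add: nn_integral_add m sum.distrib distrib_left)
  next
    case (seq U)
    have "U m x \<le> U n x" if "m \<le> n" for m n x
      using \<open>incseq U\<close> that by (simp add: incseq_def le_fun_def)
    then have inc: "incseq (\<lambda>n. ennreal (w i) * (\<integral>\<^sup>+x. U n x \<partial>\<nu> i))" for i
      unfolding incseq_def by (intro allI impI mult_left_mono nn_integral_mono) simp_all
    have sup: "(\<integral>\<^sup>+x. (SUP n. U n) x \<partial>M) = (SUP n. \<integral>\<^sup>+x. U n x \<partial>M)"
      if "\<And>n. U n \<in> borel_measurable M" for M
      unfolding SUP_apply using nn_integral_monotone_convergence_SUP[OF \<open>incseq U\<close> that] .
    have "(\<integral>\<^sup>+x. (SUP n. U n) x \<partial>mixture I w \<nu>) = (SUP n. \<integral>\<^sup>+x. U n x \<partial>mixture I w \<nu>)"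
      by (rule sup) (rule seq(1))
    also have "\<dots> = (SUP n. \<Sum>i\<in>I. ennreal (w i) * (\<integral>\<^sup>+x. U n x \<partial>\<nu> i))"
      by (simp only: seq.IH)
    also have "\<dots> = (\<Sum>i\<in>I. SUP n. ennreal (w i) * (\<integral>\<^sup>+x. U n x \<partial>\<nu> i))"
      using inc by (intro ennreal_SUP_sum) auto
    also have "\<dots> = (\<Sum>i\<in>I. ennreal (w i) * (\<integral>\<^sup>+x. (SUP n. U n) x \<partial>\<nu> i))"
      by (intro sum.cong refl, subst sup) (auto intro!: m seq(1) simp: SUP_mult_left_ennreal)
    finally show ?case .
  qed
qed

lemma mixture_eqI:
  assumes "sets M = sets borel" and "\<And>i. i \<in> I \<Longrightarrow> sets (\<nu> i) = sets borel"
    and "\<And>A. A \<in> sets borel \<Longrightarrow> emeasure M A = (\<Sum>i\<in>I. ennreal (w i) * emeasure (\<nu> i) A)"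
  shows "M = mixture I w \<nu>"
  using assms by (intro measure_eqI) (auto simp: emeasure_mixture)

text \<open>
  The components need to agree only where the weight is nonzero. This is what allows a component of
  weight zero to be replaced by an arbitrary measure.
\<close>

lemma mixture_cong:
  assumes "\<And>i. i \<in> I \<Longrightarrow> w i = w' i" "\<And>i. i \<in> I \<Longrightarrow> w' i \<noteq> 0 \<Longrightarrow> \<nu> i = \<nu>' i"
  shows "mixture I w \<nu> = mixture I w' \<nu>'"
proof -
  have "ennreal (w i) * emeasure (\<nu> i) A = ennreal (w' i) * emeasure (\<nu>' i) A" if "i \<in> I" for i A
    using assms[OF that] by (cases "w' i = 0") auto
  then show ?thesis unfolding mixture_def by simp
qed

lemma distr_mixture:
  fixes \<nu> :: "'i \<Rightarrow> 'a::euclidean_space measure" and f :: "'a \<Rightarrow> 'b::euclidean_space"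
  assumes s: "\<And>i. i \<in> I \<Longrightarrow> sets (\<nu> i) = sets borel"
    and f [measurable]: "f \<in> borel \<rightarrow>\<^sub>M borel"
  shows "distr (mixture I w \<nu>) borel f = mixture I w (\<lambda>i. distr (\<nu> i) borel f)"
proof (rule mixture_eqI)
  fix A :: "'b set" assume A: "A \<in> sets borel"
  have mf: "f \<in> M \<rightarrow>\<^sub>M borel" if "sets M = sets borel" for M
    using f that by (simp cong: measurable_cong_sets)
  have pre: "f -` A \<in> sets borel" using measurable_sets[OF f A] by simp
  have "emeasure (distr (mixture I w \<nu>) borel f) A = emeasure (mixture I w \<nu>) (f -` A)"
    using A by (simp add: emeasure_distr mf)
  also have "\<dots> = (\<Sum>i\<in>I. ennreal (w i) * emeasure (\<nu> i) (f -` A))"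
    using pre s by (simp add: emeasure_mixture)
  also have "\<dots> = (\<Sum>i\<in>I. ennreal (w i) * emeasure (distr (\<nu> i) borel f) A)"
    using A by (intro sum.cong refl)
      (simp add: emeasure_distr mf s sets_eq_imp_space_eq[OF s])
  finally show "emeasure (distr (mixture I w \<nu>) borel f) A
    = (\<Sum>i\<in>I. ennreal (w i) * emeasure (distr (\<nu> i) borel f) A)" .
qed simp_all

lemma prob_space_mixture:
  assumes "\<And>i. i \<in> I \<Longrightarrow> sets (\<nu> i) = sets borel" "\<And>i. i \<in> I \<Longrightarrow> prob_space (\<nu> i)"
    and w: "\<And>i. i \<in> I \<Longrightarrow> w i \<ge> 0" "sum w I = 1"
  shows "prob_space (mixture I w \<nu>)"
proof (rule prob_spaceI)
  have "emeasure (\<nu> i) UNIV = 1" if "i \<in> I" for i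
    using prob_space.emeasure_space_1[OF assms(2)[OF that]] sets_eq_imp_space_eq[OF assms(1)[OF that]]
    by simp
  then show "emeasure (mixture I w \<nu>) (space (mixture I w \<nu>)) = 1"
    using assms by (simp add: emeasure_mixture sum_ennreal)
qed

lemma mixture_reindex:
  assumes "bij_betw h I' I"
  shows "mixture I w \<nu> = mixture I' (w \<circ> h) (\<nu> \<circ> h)"
proof -
  have "(\<Sum>i\<in>I'. ennreal ((w \<circ> h) i) * emeasure ((\<nu> \<circ> h) i) A)
      = (\<Sum>i\<in>I. ennreal (w i) * emeasure (\<nu> i) A)" for A
    using sum.reindex_bij_betw[OF assms, of "\<lambda>i. ennreal (w i) * emeasure (\<nu> i) A"] by simp
  then show ?thesis by (simp add: mixture_def)
qed

lemma mixture_const: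
  assumes "\<And>i. i \<in> I \<Longrightarrow> w i \<ge> 0" "sum w I = 1" "sets M = sets borel"
  shows "mixture I w (\<lambda>_. M) = M"
  using assms
  by (intro mixture_eqI[symmetric]) (simp_all add: sum_ennreal flip: sum_distrib_right)

lemma mixture_drop_zero:
  assumes "finite I"
  shows "mixture I w \<nu> = mixture {i\<in>I. w i \<noteq> 0} w \<nu>"
proof -
  have "(\<Sum>i\<in>I. ennreal (w i) * emeasure (\<nu> i) A)
      = (\<Sum>i\<in>{i\<in>I. w i \<noteq> 0}. ennreal (w i) * emeasure (\<nu> i) A)" for A
    using assms by (intro sum.mono_neutral_right) auto
  then show ?thesis by (simp add: mixture_def)
qed

section \<open>The Cramer--Wold theorem\<close>

text \<open>
  One-dimensional uniqueness of characteristic functions for the law of \<open>Y\<close> under the measure with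
  density \<open>g\<close>, in the real form of cosines with an arbitrary phase \<open>c\<close>: the phases \<open>0\<close> and \<open>-pi/2\<close>
  give the real and the imaginary part. After division by the total mass \<open>Z\<close>, which is the case
  \<open>s = c = 0\<close>, the Levy uniqueness theorem applies; if \<open>Z\<close> vanishes, both sides do.
\<close>

lemma weighted_law_eqI:
  fixes M :: "'a measure" and N :: "'b measure" and g :: "'a \<Rightarrow> real" and g' :: "'b \<Rightarrow> real"
    and Y :: "'a \<Rightarrow> real" and Y' :: "'b \<Rightarrow> real"
  assumes M: "finite_measure M" and N: "finite_measure N"
    and [measurable]: "Y \<in> borel_measurable M" "Y' \<in> borel_measurable N"
      "g \<in> borel_measurable M" "g' \<in> borel_measurable N"
    and g: "\<And>x. 0 \<le> g x" "\<And>x. g x \<le> C" "\<And>x. 0 \<le> g' x" "\<And>x. g' x \<le> C"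
    and eq: "\<And>s c. (\<integral>x. g x * cos (s * Y x + c) \<partial>M) = (\<integral>x. g' x * cos (s * Y' x + c) \<partial>N)"
    and A [measurable]: "A \<in> sets borel"
  shows "(\<integral>x. g x * indicator A (Y x) \<partial>M) = (\<integral>x. g' x * indicator A (Y' x) \<partial>N)"
proof -
  interpret M: finite_measure M by fact
  interpret N: finite_measure N by fact
  define Z where "Z = (\<integral>x. g x \<partial>M)"
  have ZN: "Z = (\<integral>x. g' x \<partial>N)" using eq[of 0 0] by (simp add: Z_def)
  have ig: "integrable M g" "integrable N g'"
    using g by (auto intro!: M.integrable_const_bound[where B=C] N.integrable_const_bound[where B=C])
  have Z0: "Z \<ge> 0" unfolding Z_def using g by (intro integral_nonneg_AE) auto
  show ?thesis
  proof (cases "Z = 0")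
    case True
    then have "AE x in M. g x = 0" "AE x in N. g' x = 0"
      using ig g integral_nonneg_eq_0_iff_AE[of M g] integral_nonneg_eq_0_iff_AE[of N g']
      by (auto simp: Z_def[symmetric] ZN[symmetric])
    then have "(\<integral>x. g x * indicator A (Y x) \<partial>M) = 0" "(\<integral>x. g' x * indicator A (Y' x) \<partial>N) = 0"
      by (auto intro!: integral_eq_zero_AE)
    then show ?thesis by simp
  next
    case False
    then have Z: "Z > 0" using Z0 by simp
    have law: "real_distribution (distr (density L (\<lambda>x. h x / Z)) borel X)
        \<and> (\<forall>s. char (distr (density L (\<lambda>x. h x / Z)) borel X) s
            = Complex ((\<integral>x. h x * cos (s * X x) \<partial>L) / Z) ((\<integral>x. h x * cos (s * X x - pi/2) \<partial>L) / Z))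
        \<and> measure (distr (density L (\<lambda>x. h x / Z)) borel X) A = (\<integral>x. h x * indicator A (X x) \<partial>L) / Z"
      if L: "finite_measure L" and [measurable]: "X \<in> borel_measurable L" "h \<in> borel_measurable L"
        and h: "\<And>x. 0 \<le> h x" "integrable L h" "(\<integral>x. h x \<partial>L) = Z"
      for L :: "'c measure" and X h :: "'c \<Rightarrow> real"
    proof -
      interpret finite_measure L by fact
      let ?D = "density L (\<lambda>x. h x / Z)"
      have int: "(\<integral>\<^sup>+ x. ennreal (h x / Z) \<partial>L) = 1"
        using h Z by (subst nn_integral_eq_integral) auto
      interpret D: prob_space ?D
        using int by (intro prob_spaceI) (simp add: emeasure_density cong: nn_integral_cong)
      interpret D': real_distribution "distr ?D borel X" by (rule D.real_distribution_distr) simp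
      have icos: "integrable L (\<lambda>x. h x * cos (u x))" if [measurable]: "u \<in> borel_measurable L" for u
        using h by (intro Bochner_Integration.integrable_bound[OF h(2)])
          (auto simp: abs_mult intro!: mult_left_le)
      have "char (distr ?D borel X) s
          = Complex ((\<integral>x. h x * cos (s * X x) \<partial>L) / Z) ((\<integral>x. h x * cos (s * X x - pi/2) \<partial>L) / Z)" for s
      proof -
        have "char (distr ?D borel X) s = (CLINT x|?D. iexp (s * X x))"
          unfolding char_def by (subst integral_distr) auto
        also have "\<dots> = (CLINT x|L. (h x / Z) *\<^sub>R iexp (s * X x))"
          using h Z by (subst integral_density) auto
        finally have c: "char (distr ?D borel X) s = (CLINT x|L. (h x / Z) *\<^sub>R iexp (s * X x))" .
        have i: "integrable L (\<lambda>x. (h x / Z) *\<^sub>R iexp (s * X x))"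
          using h Z
          by (intro Bochner_Integration.integrable_bound[OF integrable_divide_zero[of Z L h, OF h(2)]])
            auto
        show ?thesis
        proof (rule complex_eqI)
          show "Re (char (distr ?D borel X) s) = Re (Complex ((\<integral>x. h x * cos (s * X x) \<partial>L) / Z) ((\<integral>x. h x * cos (s * X x - pi/2) \<partial>L) / Z))"
            using i by (simp add: c flip: integral_Re) (simp add: Re_exp)
          show "Im (char (distr ?D borel X) s) = Im (Complex ((\<integral>x. h x * cos (s * X x) \<partial>L) / Z) ((\<integral>x. h x * cos (s * X x - pi/2) \<partial>L) / Z))"
            using i by (simp add: c flip: integral_Im) (simp add: Im_exp cos_diff)
        qed
      qed
      moreover have "measure (distr ?D borel X) A = (\<integral>x. h x * indicator A (X x) \<partial>L) / Z"
      proof -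
        have "measure (distr ?D borel X) A = (\<integral>x. indicator A x \<partial>distr ?D borel X)"
          by simp
        also have "\<dots> = (\<integral>x. indicator A (X x) \<partial>?D)"
          by (subst integral_distr) auto
        also have "\<dots> = (\<integral>x. (h x / Z) * indicator A (X x) \<partial>L)"
          using h Z by (subst integral_density) auto
        finally show ?thesis by simp
      qed
      ultimately show ?thesis using D'.real_distribution_axioms by blast
    qed
    note lM = law[OF M assms(3,5) g(1) ig(1) Z_def[symmetric]]
    note lN = law[OF N assms(4,6) g(3) ig(2) ZN[symmetric]]
    have "distr (density M (\<lambda>x. g x / Z)) borel Y = distr (density N (\<lambda>x. g' x / Z)) borel Y'"
      using lM lN eq[of _ 0] eq[of _ "-pi/2"] by (intro Levy_uniqueness) auto
    then have "(\<integral>x. g x * indicator A (Y x) \<partial>M) / Z = (\<integral>x. g' x * indicator A (Y' x) \<partial>N) / Z"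
      unfolding lM[THEN conjunct2, THEN conjunct2, symmetric] lN[THEN conjunct2, THEN conjunct2, symmetric]
      by simp
    then show ?thesis using Z by simp
  qed
qed

text \<open>
  The coordinates are turned from Fourier variables into events one at a time. Suppose that the
  integrals of \<open>P * cos (t \<bullet> x + c)\<close> agree for all \<open>t\<close> and \<open>c\<close>, where \<open>P\<close> is the indicator of an
  event in the coordinates treated so far. Use \<open>P * (1 + cos (t \<bullet> x + c))\<close>, which is nonnegative, as
  a density and look at the law of one further coordinate \<open>b \<bullet> x\<close>. By the product formula for
  cosines its Fourier integrals are again of the assumed form, so these laws agree by
  \<open>weighted_law_eqI\<close>; so do the laws with density \<open>P\<close>. Their difference is the claim for one more
  coordinate. When all coordinates are used up, the measures agree on boxes.
\<close>

theorem Cramer_Wold: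
  fixes M N :: "'a::euclidean_space measure"
  assumes M: "prob_space M" and N: "prob_space N"
    and sM [measurable_cong]: "sets M = sets borel" and sN [measurable_cong]: "sets N = sets borel"
    and eq: "\<And>t. distr M borel (\<lambda>x. t \<bullet> x) = distr N borel (\<lambda>x. t \<bullet> x)"
  shows "M = N"
proof -
  interpret M: prob_space M by fact
  interpret N: prob_space N by fact
  have cyl: "(\<integral>x. (\<Prod>b\<in>S. indicator (A b) (b \<bullet> x)) * cos (t \<bullet> x + c) \<partial>M)
      = (\<integral>x. (\<Prod>b\<in>S. indicator (A b) (b \<bullet> x)) * cos (t \<bullet> x + c) \<partial>N)"
    if "finite S" "\<And>b. A b \<in> sets borel" for S and A :: "'a \<Rightarrow> real set" and t c
    using that(1)
  proof (induction S arbitrary: t c)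
    case empty
    have "(\<integral>y. cos (y + c) \<partial>distr M borel (\<lambda>x. t \<bullet> x)) = (\<integral>y. cos (y + c) \<partial>distr N borel (\<lambda>x. t \<bullet> x))"
      by (simp add: eq)
    then show ?case by (simp add: integral_distr)
  next
    case (insert b S)
    note [measurable] = that(2)
    let ?P = "\<lambda>x. \<Prod>b\<in>S. indicator (A b) (b \<bullet> x) :: real"
    have P: "0 \<le> ?P x" "?P x \<le> 1" for x
      by (auto intro!: prod_nonneg prod_le_1)
    have bd: "integrable M f \<and> integrable N f"
      if "f \<in> borel_measurable borel" "\<And>x. \<bar>f x\<bar> \<le> 2" for f :: "'a \<Rightarrow> real"
      using that by (auto intro!: M.integrable_const_bound[where B=2] N.integrable_const_bound[where B=2])
    have Pc: "integrable M (\<lambda>x. ?P x * cos (u \<bullet> x + d)) \<and> integrable N (\<lambda>x. ?P x * cos (u \<bullet> x + d))"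
      for u d
    proof (rule bd)
      show "\<bar>?P x * cos (u \<bullet> x + d)\<bar> \<le> 2" for x
        using mult_mono[of "\<bar>?P x\<bar>" 1 "\<bar>cos (u \<bullet> x + d)\<bar>" 1] P[of x] by (simp add: abs_mult)
    qed simp
    have Pb: "integrable M (\<lambda>x. ?P x * indicator (A b) (b \<bullet> x) * f x)
        \<and> integrable N (\<lambda>x. ?P x * indicator (A b) (b \<bullet> x) * f x)"
      if [measurable]: "f \<in> borel_measurable borel" and f: "\<And>x. 0 \<le> f x" "\<And>x. f x \<le> 2" for f :: "'a \<Rightarrow> real"
    proof (rule bd)
      show "\<bar>?P x * indicator (A b) (b \<bullet> x) * f x\<bar> \<le> 2" for x
        using mult_mono[of "\<bar>?P x\<bar>" 1 "\<bar>f x\<bar>" 2] P[of x] f[of x] by (simp add: abs_mult indicator_def)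
    qed simp
    have Pb1: "integrable M (\<lambda>x. ?P x * indicator (A b) (b \<bullet> x))
        \<and> integrable N (\<lambda>x. ?P x * indicator (A b) (b \<bullet> x))"
      using Pb[of "\<lambda>_. 1"] by simp
    have c1: "0 \<le> 1 + cos y" "1 + cos y \<le> 2" for y :: real
      using cos_ge_minus_one[of y] cos_le_one[of y] by linarith+
    have Pb2: "integrable M (\<lambda>x. ?P x * (1 + cos (t \<bullet> x + c)) * indicator (A b) (b \<bullet> x))
        \<and> integrable N (\<lambda>x. ?P x * (1 + cos (t \<bullet> x + c)) * indicator (A b) (b \<bullet> x))"
      using Pb[of "\<lambda>x. 1 + cos (t \<bullet> x + c)"] c1 by (simp add: ac_simps)
    \<comment> \<open>The product formula for cosines stays within the family of integrands covered by the
      induction hypothesis.\<close>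
    have w: "?P x * (1 + cos (t \<bullet> x + c)) * cos (s * (b \<bullet> x) + d)
      = ?P x * cos ((s *\<^sub>R b) \<bullet> x + d) + (?P x * cos ((t + s *\<^sub>R b) \<bullet> x + (c + d))
          + ?P x * cos ((t - s *\<^sub>R b) \<bullet> x + (c - d))) / 2" for x s d
    proof -
      have "cos (t \<bullet> x + c) * cos (s * (b \<bullet> x) + d)
        = (cos ((t - s *\<^sub>R b) \<bullet> x + (c - d)) + cos ((t + s *\<^sub>R b) \<bullet> x + (c + d))) / 2"
        by (simp add: cos_times_cos inner_add_left inner_diff_left algebra_simps)
      then show ?thesis by (simp add: distrib_left distrib_right mult.assoc add_divide_distrib)
    qed
    have Wb: "0 \<le> ?P x * (1 + cos (t \<bullet> x + c))" "?P x * (1 + cos (t \<bullet> x + c)) \<le> 2" for x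
      using mult_mono[of "?P x" 1 "1 + cos (t \<bullet> x + c)" 2] P[of x] c1[of "t \<bullet> x + c"] by simp_all
    have 1: "(\<integral>x. (?P x * (1 + cos (t \<bullet> x + c))) * indicator (A b) (b \<bullet> x) \<partial>M)
        = (\<integral>x. (?P x * (1 + cos (t \<bullet> x + c))) * indicator (A b) (b \<bullet> x) \<partial>N)"
    proof (rule weighted_law_eqI[where C=2])
      fix s d
      show "(\<integral>x. ?P x * (1 + cos (t \<bullet> x + c)) * cos (s * (b \<bullet> x) + d) \<partial>M)
        = (\<integral>x. ?P x * (1 + cos (t \<bullet> x + c)) * cos (s * (b \<bullet> x) + d) \<partial>N)"
        unfolding w using Pc insert.IH by (simp del: inner_scaleR_left)
    qed (simp_all add: Wb M.finite_measure_axioms N.finite_measure_axioms)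
    have 2: "(\<integral>x. ?P x * indicator (A b) (b \<bullet> x) \<partial>M) = (\<integral>x. ?P x * indicator (A b) (b \<bullet> x) \<partial>N)"
    proof (rule weighted_law_eqI[where C=1])
      fix s d
      show "(\<integral>x. ?P x * cos (s * (b \<bullet> x) + d) \<partial>M) = (\<integral>x. ?P x * cos (s * (b \<bullet> x) + d) \<partial>N)"
        using insert.IH[of "s *\<^sub>R b" d] by simp
    qed (simp_all add: M.finite_measure_axioms N.finite_measure_axioms P)
    have e: "(\<Prod>b\<in>insert b S. indicator (A b) (b \<bullet> x)) * cos (t \<bullet> x + c)
      = (?P x * (1 + cos (t \<bullet> x + c))) * indicator (A b) (b \<bullet> x) - ?P x * indicator (A b) (b \<bullet> x)" for x
      using insert.hyps by (simp add: algebra_simps)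
    show ?case unfolding e using 1 2 Pb1 Pb2 by simp
  qed
  show ?thesis
  proof (rule measure_eqI_generator_eq)
    let ?E = "range (\<lambda>(a, b). box a b) :: 'a set set"
    show "Int_stable ?E" by (auto simp: Int_stable_def box_Int_box)
    show "sets M = sigma_sets UNIV ?E" "sets N = sigma_sets UNIV ?E"
      using sM sN by (simp_all add: borel_eq_box)
    fix X assume "X \<in> ?E"
    then obtain l u where X: "X = box l u" by auto
    have ind: "indicator X x = (\<Prod>b\<in>Basis. indicator {l \<bullet> b<..<u \<bullet> b} (b \<bullet> x) :: real)" for x
    proof (cases "x \<in> X")
      case True
      then show ?thesis by (auto simp: X box_def inner_commute intro!: prod.neutral[symmetric])
    next
      case False
      then obtain b where "b \<in> Basis" "b \<bullet> x \<notin> {l \<bullet> b<..<u \<bullet> b}"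
        by (auto simp: X box_def inner_commute)
      then have "(\<Prod>b\<in>Basis. indicator {l \<bullet> b<..<u \<bullet> b} (b \<bullet> x) :: real) = 0"
        by (intro prod_zero finite_Basis bexI[of _ b]) simp_all
      then show ?thesis using False by simp
    qed
    have "measure M X = (\<integral>x. indicator X x \<partial>M)" "measure N X = (\<integral>x. indicator X x \<partial>N)"
      using X by (simp_all add: sM sN)
    then have "measure M X = measure N X"
      using cyl[of Basis "\<lambda>b. {l \<bullet> b<..<u \<bullet> b}" 0 0] by (simp add: ind)
    then show "emeasure M X = emeasure N X"
      by (simp add: M.emeasure_eq_measure N.emeasure_eq_measure)
  next
    show "range (\<lambda>n::nat. box (- (real n *\<^sub>R One)) (real n *\<^sub>R One)) \<subseteq> range (\<lambda>(a, b). box a b :: 'a set)"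
      by auto
    show "(\<Union>n::nat. box (- (real n *\<^sub>R One)) (real n *\<^sub>R One)) = (UNIV :: 'a set)"
      by (rule UN_box_eq_UNIV)
  qed simp_all
qed

section \<open>Gaussian measures and their covariance forms\<close>

lemma sets_normal_law [simp, measurable_cong]: "sets (normal_law m \<sigma>) = sets borel"
  by (simp add: normal_law_def)

lemma normal_law_eq_distr:
  assumes "\<sigma> \<ge> 0"
  shows "normal_law m \<sigma> = distr std_normal_distribution borel (\<lambda>x. m + \<sigma> * x)"
proof -
  interpret real_distribution std_normal_distribution by (rule real_dist_normal_dist)
  show ?thesis
  proof (cases "\<sigma> = 0")
    case True
    have "distr std_normal_distribution borel (\<lambda>x. m) = return borel m"
      by (rule distr_const) simp
    then show ?thesis using True by (simp add: normal_law_def)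
  next
    case False
    have "distributed std_normal_distribution lborel (\<lambda>x. x) std_normal_density"
      by (auto simp: distributed_def distr_id2)
    from normal_density_affine[OF this, of \<sigma> m]
    have "distributed std_normal_distribution lborel (\<lambda>x. m + x * \<sigma>) (normal_density m \<sigma>)"
      using assms False by (simp add: mult.commute)
    then have "distr std_normal_distribution lborel (\<lambda>x. m + \<sigma> * x) = density lborel (normal_density m \<sigma>)"
      by (simp add: distributed_def mult.commute)
    then show ?thesis
      using False by (simp add: normal_law_def cong: distr_cong)
  qed
qed

lemma real_distribution_normal_law: "\<sigma> \<ge> 0 \<Longrightarrow> real_distribution (normal_law m \<sigma>)"
  by (simp add: normal_law_eq_distr prob_space.real_distribution_distr
      prob_space_normal_density)

lemma char_normal_law:
  assumes "\<sigma> \<ge> 0"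
  shows "char (normal_law m \<sigma>) t = iexp (t * m) * exp (- (t * \<sigma>)\<^sup>2 / 2)"
proof -
  have "char (normal_law m \<sigma>) t = (CLINT x|std_normal_distribution. iexp (t * (m + \<sigma> * x)))"
    unfolding char_def normal_law_eq_distr[OF assms] by (subst integral_distr) auto
  also have "\<dots> = (CLINT x|std_normal_distribution. iexp (t * m) * iexp (t * \<sigma> * x))"
    by (simp add: algebra_simps exp_add)
  also have "\<dots> = iexp (t * m) * char std_normal_distribution (t * \<sigma>)"
    unfolding char_def by (rule integral_mult_right_zero)
  finally show ?thesis by (simp add: char_std_normal_distribution)
qed

text \<open>
  As an identity of nonnegative integrals this needs no integrability of the exponential, and it
  extends to mixtures by linearity.
\<close>

lemma laplace_normal_law:
  assumes "\<sigma> \<ge> 0"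
  shows "(\<integral>\<^sup>+x. ennreal (exp (s * x)) \<partial>normal_law m \<sigma>) = ennreal (exp (s * m + s\<^sup>2 * \<sigma>\<^sup>2 / 2))"
proof (cases "\<sigma> = 0")
  case True
  then show ?thesis by (simp add: normal_law_def nn_integral_return)
next
  case False
  \<comment> \<open>complete the square\<close>
  have sq: "exp (s * x) * normal_density m \<sigma> x
      = exp (s * m + s\<^sup>2 * \<sigma>\<^sup>2 / 2) * normal_density (m + s * \<sigma>\<^sup>2) \<sigma> x" for x
  proof -
    have "s * x + - ((x - m)\<^sup>2 / (2 * \<sigma>\<^sup>2))
      = (s * m + s\<^sup>2 * \<sigma>\<^sup>2 / 2) + - ((x - (m + s * \<sigma>\<^sup>2))\<^sup>2 / (2 * \<sigma>\<^sup>2))"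
      using False by (simp add: field_simps power2_eq_square)
    then have "exp (s * x) * exp (- ((x - m)\<^sup>2 / (2 * \<sigma>\<^sup>2)))
      = exp (s * m + s\<^sup>2 * \<sigma>\<^sup>2 / 2) * exp (- ((x - (m + s * \<sigma>\<^sup>2))\<^sup>2 / (2 * \<sigma>\<^sup>2)))"
      by (simp flip: exp_add)
    then show ?thesis by (simp add: normal_density_def)
  qed
  have "(\<integral>\<^sup>+x. ennreal (exp (s * x)) \<partial>normal_law m \<sigma>)
      = (\<integral>\<^sup>+x. ennreal (exp (s * x) * normal_density m \<sigma> x) \<partial>lborel)"
    using False by (simp add: normal_law_def nn_integral_density ennreal_mult' mult.commute)
  also have "\<dots> = ennreal (exp (s * m + s\<^sup>2 * \<sigma>\<^sup>2 / 2))
      * (\<integral>\<^sup>+x. ennreal (normal_density (m + s * \<sigma>\<^sup>2) \<sigma> x) \<partial>lborel)"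
    unfolding sq by (simp add: ennreal_mult' nn_integral_cmult)
  also have "(\<integral>\<^sup>+x. ennreal (normal_density (m + s * \<sigma>\<^sup>2) \<sigma> x) \<partial>lborel) = 1"
    using False assms by (subst nn_integral_eq_integral) auto
  finally show ?thesis by simp
qed

lemma normal_law_moments:
  assumes "\<sigma> \<ge> 0"
  shows "integrable (normal_law m \<sigma>) (\<lambda>x. x)" "(\<integral>x. x \<partial>normal_law m \<sigma>) = m"
    "integrable (normal_law m \<sigma>) (\<lambda>x. x\<^sup>2)" "(\<integral>x. x\<^sup>2 \<partial>normal_law m \<sigma>) = \<sigma>\<^sup>2 + m\<^sup>2"
proof -
  interpret real_distribution std_normal_distribution by (rule real_dist_normal_dist)
  have i: "integrable std_normal_distribution (\<lambda>x. x)" "integrable std_normal_distribution (\<lambda>x. x\<^sup>2)"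
    using integrable_std_normal_distribution_moment[of 1] integrable_std_normal_distribution_moment[of 2]
    by simp_all
  have e: "(\<integral>x. x \<partial>std_normal_distribution) = 0" "(\<integral>x. x\<^sup>2 \<partial>std_normal_distribution) = 1"
    using integral_std_normal_distribution_moment_odd[of 1] std_normal_distribution_even_moments(1)[of 1]
    by simp_all
  have c: "prob UNIV = 1"
    using prob_space by simp
  have sq: "(m + \<sigma> * x)\<^sup>2 = m\<^sup>2 + (2 * m * \<sigma> * x + \<sigma>\<^sup>2 * x\<^sup>2)" for x
    by (simp add: power2_sum power_mult_distrib)
  show "integrable (normal_law m \<sigma>) (\<lambda>x. x)"
    unfolding normal_law_eq_distr[OF assms]
    by (subst integrable_distr_eq) (simp_all add: i)
  show "integrable (normal_law m \<sigma>) (\<lambda>x. x\<^sup>2)"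
    unfolding normal_law_eq_distr[OF assms]
    by (subst integrable_distr_eq) (simp_all add: sq i)
  have "(\<integral>x. x \<partial>normal_law m \<sigma>) = (\<integral>x. m + \<sigma> * x \<partial>std_normal_distribution)"
    unfolding normal_law_eq_distr[OF assms] by (subst integral_distr) auto
  then show "(\<integral>x. x \<partial>normal_law m \<sigma>) = m" by (simp add: i e c)
  have "(\<integral>x. x\<^sup>2 \<partial>normal_law m \<sigma>) = (\<integral>x. (m + \<sigma> * x)\<^sup>2 \<partial>std_normal_distribution)"
    unfolding normal_law_eq_distr[OF assms] by (subst integral_distr) auto
  then show "(\<integral>x. x\<^sup>2 \<partial>normal_law m \<sigma>) = \<sigma>\<^sup>2 + m\<^sup>2" by (simp add: sq i e c)
qed

text \<open>
  Covariances are handled as symmetric positive semidefinite bilinear forms on the space itself, so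
  that neither matrices nor a choice of coordinates enters the argument.
\<close>

definition psd_form :: "('a::euclidean_space \<Rightarrow> 'a \<Rightarrow> real) \<Rightarrow> bool" where
  "psd_form q \<longleftrightarrow> (\<forall>s s' t. q (s + s') t = q s t + q s' t) \<and>
    (\<forall>c s t. q (c *\<^sub>R s) t = c * q s t) \<and> (\<forall>s t. q s t = q t s) \<and> (\<forall>t. 0 \<le> q t t)"

lemma psd_formD:
  assumes "psd_form q"
  shows "q (s + s') t = q s t + q s' t" "q (c *\<^sub>R s) t = c * q s t"
    "q s (t + t') = q s t + q s t'" "q s (c *\<^sub>R t) = c * q s t" "q s t = q t s" "0 \<le> q t t"
proof -
  show add: "q (s + s') t = q s t + q s' t" and scale: "q (c *\<^sub>R s) t = c * q s t"
    and sym: "q s t = q t s" and "0 \<le> q t t" for s s' t c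
    using assms unfolding psd_form_def by blast+
  show "q s (t + t') = q s t + q s t'" "q s (c *\<^sub>R t) = c * q s t"
    unfolding sym[of s] add scale by (rule refl)+
qed

lemma psd_form_bilinear:
  assumes "psd_form q"
  shows "bilinear q"
  unfolding bilinear_def by (intro conjI allI linearI) (simp_all add: psd_formD[OF assms])

definition mean :: "'a::euclidean_space measure \<Rightarrow> 'a" where
  "mean M = (\<integral>x. x \<partial>M)"

definition cov :: "'a::euclidean_space measure \<Rightarrow> 'a \<Rightarrow> 'a \<Rightarrow> real" where
  "cov M s t = (\<integral>x. (s \<bullet> (x - mean M)) * (t \<bullet> (x - mean M)) \<partial>M)"

text \<open>
  Second moments are all that the quadratic cost sees. Couplings of Gaussians are in this class
  without being Gaussian.
\<close>

locale square_integrable_law = prob_space M for M :: "'a::euclidean_space measure" +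
  assumes sets_eq_borel [simp, measurable_cong]: "sets M = sets borel"
    and integrable_inner_square: "integrable M (\<lambda>x. (t \<bullet> x)\<^sup>2)"
begin

lemma integrable_inner: "integrable M (\<lambda>x. t \<bullet> x)"
proof (rule Bochner_Integration.integrable_bound)
  show "integrable M (\<lambda>x. 1 + (t \<bullet> x)\<^sup>2)" using integrable_inner_square by simp
  have "\<bar>a\<bar> \<le> 1 + a\<^sup>2" for a :: real
    using zero_le_power2[of "\<bar>a\<bar> - 1"] by (simp add: power2_diff)
  then show "AE x in M. norm (t \<bullet> x) \<le> norm (1 + (t \<bullet> x)\<^sup>2)" by simp
qed measurable

lemma integrable_inner_mult: "integrable M (\<lambda>x. (s \<bullet> x) * (t \<bullet> x))"
proof -
  have eq: "(s \<bullet> x) * (t \<bullet> x) = (((s + t) \<bullet> x)\<^sup>2 - (s \<bullet> x)\<^sup>2 - (t \<bullet> x)\<^sup>2) / 2" for x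
    by (simp add: inner_add_left power2_sum)
  show ?thesis unfolding eq
    by (intro integrable_divide Bochner_Integration.integrable_diff integrable_inner_square)
qed

lemma inner_mean: "(\<integral>x. t \<bullet> x \<partial>M) = t \<bullet> mean M"
proof -
  have "integrable M (\<lambda>x. \<Sum>b\<in>Basis. (b \<bullet> x) *\<^sub>R b)"
    using integrable_inner by auto
  then have "integrable M (\<lambda>x. x)"
    by (simp add: inner_commute euclidean_representation)
  then show ?thesis by (simp add: mean_def)
qed

lemma integrable_centred_mult:
  "integrable M (\<lambda>x. (s \<bullet> (x - v)) * (t \<bullet> (x - v)))"
proof -
  have "(s \<bullet> (x - v)) * (t \<bullet> (x - v))
    = (s \<bullet> x) * (t \<bullet> x) - (t \<bullet> v) * (s \<bullet> x) - (s \<bullet> v) * (t \<bullet> x) + (s \<bullet> v) * (t \<bullet> v)" for x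
    by (simp add: inner_diff_right algebra_simps)
  then show ?thesis using integrable_inner_mult integrable_inner by simp
qed

lemma psd_form_cov: "psd_form (cov M)"
  unfolding psd_form_def cov_def
proof (intro conjI allI)
  fix s s' t c
  show "(\<integral>x. ((s + s') \<bullet> (x - mean M)) * (t \<bullet> (x - mean M)) \<partial>M)
    = (\<integral>x. (s \<bullet> (x - mean M)) * (t \<bullet> (x - mean M)) \<partial>M)
      + (\<integral>x. (s' \<bullet> (x - mean M)) * (t \<bullet> (x - mean M)) \<partial>M)"
    using integrable_centred_mult by (simp add: inner_add_left distrib_right)
  show "(\<integral>x. (c *\<^sub>R s \<bullet> (x - mean M)) * (t \<bullet> (x - mean M)) \<partial>M)
    = c * (\<integral>x. (s \<bullet> (x - mean M)) * (t \<bullet> (x - mean M)) \<partial>M)"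
    by (simp add: mult.assoc)
  show "(\<integral>x. (s \<bullet> (x - mean M)) * (t \<bullet> (x - mean M)) \<partial>M)
    = (\<integral>x. (t \<bullet> (x - mean M)) * (s \<bullet> (x - mean M)) \<partial>M)"
    by (simp add: mult.commute)
  show "0 \<le> (\<integral>x. (t \<bullet> (x - mean M)) * (t \<bullet> (x - mean M)) \<partial>M)"
    by (intro integral_nonneg_AE) simp
qed

lemma second_moment: "(\<integral>x. (t \<bullet> x)\<^sup>2 \<partial>M) = cov M t t + (t \<bullet> mean M)\<^sup>2"
proof -
  have "cov M t t = (\<integral>x. (t \<bullet> x)\<^sup>2 - 2 * (t \<bullet> mean M) * (t \<bullet> x) + (t \<bullet> mean M)\<^sup>2 \<partial>M)"
    by (simp add: cov_def inner_diff_right power2_eq_square algebra_simps)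
  also have "\<dots> = (\<integral>x. (t \<bullet> x)\<^sup>2 \<partial>M) - 2 * (t \<bullet> mean M) * (t \<bullet> mean M) + (t \<bullet> mean M)\<^sup>2"
    using integrable_inner_square integrable_inner by (simp add: inner_mean prob_space)
  finally show ?thesis by (simp add: power2_eq_square)
qed

end

text \<open>
  The definition of a Gaussian only asserts that each image has some normal law; its parameters are
  found by comparing the first two moments.
\<close>

lemma gaussian_measureD:
  assumes "gaussian_measure M"
  shows "square_integrable_law M"
    "distr M borel (\<lambda>x. t \<bullet> x) = normal_law (t \<bullet> mean M) (sqrt (cov M t t))"
proof -
  have s [measurable_cong]: "sets M = sets borel" using assms by (simp add: gaussian_measure_def)
  have ex: "\<exists>m \<sigma>. \<sigma> \<ge> 0 \<and> distr M borel (\<lambda>x. t \<bullet> x) = normal_law m \<sigma>" for t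
    using assms by (simp add: gaussian_measure_def)
  have int: "integrable M (\<lambda>x. (t \<bullet> x)\<^sup>2)" for t
  proof -
    obtain m \<sigma> where "\<sigma> \<ge> 0" and d: "distr M borel (\<lambda>x. t \<bullet> x) = normal_law m \<sigma>" using ex by blast
    then have "integrable (distr M borel (\<lambda>x. t \<bullet> x)) (\<lambda>x. x\<^sup>2)" by (simp add: normal_law_moments)
    then show ?thesis by (simp add: integrable_distr_eq)
  qed
  obtain m \<sigma> where "\<sigma> \<ge> 0" "distr M borel (\<lambda>x. 0 \<bullet> x) = normal_law m \<sigma>" using ex by blast
  then have "prob_space (distr M borel (\<lambda>x. 0 \<bullet> x))"
    using real_distribution_normal_law[of \<sigma> m] by (simp add: real_distribution_def)
  then have "prob_space M" by (rule prob_space_distrD[rotated]) simp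
  then interpret prob_space M .
  interpret square_integrable_law M by standard (auto simp: s int)
  show "square_integrable_law M" by unfold_locales
  obtain m \<sigma> where \<sigma>: "\<sigma> \<ge> 0" and d: "distr M borel (\<lambda>x. t \<bullet> x) = normal_law m \<sigma>" using ex by blast
  have "(\<integral>x. x \<partial>distr M borel (\<lambda>x. t \<bullet> x)) = m" "(\<integral>x. x\<^sup>2 \<partial>distr M borel (\<lambda>x. t \<bullet> x)) = \<sigma>\<^sup>2 + m\<^sup>2"
    by (simp_all add: d normal_law_moments[OF \<sigma>])
  then have m: "m = t \<bullet> mean M" and "\<sigma>\<^sup>2 + m\<^sup>2 = cov M t t + (t \<bullet> mean M)\<^sup>2"
    by (simp_all add: integral_distr inner_mean second_moment)
  then have "\<sigma> = sqrt (cov M t t)" using \<sigma> by (simp add: real_sqrt_unique)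
  then show "distr M borel (\<lambda>x. t \<bullet> x) = normal_law (t \<bullet> mean M) (sqrt (cov M t t))"
    using d m by simp
qed

lemma gaussian_prob: "gaussian_measure M \<Longrightarrow> prob_space M"
  and gaussian_sets: "gaussian_measure M \<Longrightarrow> sets M = sets borel"
  by (fact square_integrable_law.axioms(1)[OF gaussian_measureD(1)]) (simp add: gaussian_measure_def)

lemma gaussian_eqI:
  assumes "gaussian_measure M" "gaussian_measure N"
    and "mean M = mean N" "\<And>t. cov M t t = cov N t t"
  shows "M = N"
proof (rule Cramer_Wold)
  show "distr M borel (\<lambda>x. t \<bullet> x) = distr N borel (\<lambda>x. t \<bullet> x)" for t
    unfolding gaussian_measureD(2)[OF assms(1)] gaussian_measureD(2)[OF assms(2)] assms(3,4) ..
qed (fact gaussian_prob[OF assms(1)] gaussian_prob[OF assms(2)]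
    gaussian_sets[OF assms(1)] gaussian_sets[OF assms(2)])+

lemma gaussian_distr_linear:
  fixes f :: "'a::euclidean_space \<Rightarrow> 'b::euclidean_space"
  assumes M: "gaussian_measure M" and f: "linear f"
  shows "gaussian_measure (distr M borel f)"
proof -
  have [measurable_cong]: "sets M = sets borel" using M by (rule gaussian_sets)
  have [measurable]: "f \<in> borel_measurable borel"
    using f by (intro borel_measurable_continuous_onI linear_continuous_on) (simp add: linear_linear)
  have "distr (distr M borel f) borel (\<lambda>y. t \<bullet> y) = distr M borel (\<lambda>x. adjoint f t \<bullet> x)" for t
    using adjoint_works[OF f]
    by (simp add: distr_distr o_def inner_commute)
  then show ?thesis
    using M by (simp add: gaussian_measure_def)
qed

lemma laplace_gaussian:
  assumes "gaussian_measure M"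
  shows "(\<integral>\<^sup>+x. ennreal (exp (s * (t \<bullet> x))) \<partial>M) = ennreal (exp (s * (t \<bullet> mean M) + s\<^sup>2 * (cov M t t / 2)))"
proof -
  interpret square_integrable_law M using assms by (rule gaussian_measureD)
  have c: "cov M t t \<ge> 0" using psd_form_cov by (simp add: psd_form_def)
  have "(\<integral>\<^sup>+x. ennreal (exp (s * (t \<bullet> x))) \<partial>M) = (\<integral>\<^sup>+y. ennreal (exp (s * y)) \<partial>distr M borel (\<lambda>x. t \<bullet> x))"
    by (subst nn_integral_distr) auto
  then show ?thesis
    using c by (simp add: gaussian_measureD(2)[OF assms] laplace_normal_law)
qed

section \<open>Identifiability of Gaussian mixtures\<close>

text \<open>
  Divide by the term of fastest growth among those with nonzero coefficient, that is, the one with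
  the largest \<open>b\<close> and, among these, the largest \<open>a\<close>. As \<open>s\<close> tends to infinity, all other terms
  vanish and the coefficient of this term is what remains.
\<close>

lemma exp_quadratic_linear_independent:
  fixes a b d :: "'i \<Rightarrow> real"
  assumes fin: "finite G" and inj: "inj_on (\<lambda>i. (a i, b i)) G"
    and zero: "\<And>s. (\<Sum>i\<in>G. d i * exp (s * a i + s\<^sup>2 * b i)) = 0"
    and i: "i \<in> G"
  shows "d i = 0"
proof (rule ccontr)
  assume "d i \<noteq> 0"
  define G' where "G' = {i\<in>G. d i \<noteq> 0}"
  have G': "finite G'" "G' \<noteq> {}" using fin i \<open>d i \<noteq> 0\<close> by (auto simp: G'_def)
  define b0 where "b0 = Max (b ` G')"
  define G'' where "G'' = {i\<in>G'. b i = b0}"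
  have "b0 \<in> b ` G'" unfolding b0_def using G' by (intro Max_in) auto
  then have G'': "finite G''" "G'' \<noteq> {}" using G' by (auto simp: G''_def)
  have "Max (a ` G'') \<in> a ` G''" using G'' by (intro Max_in) auto
  then obtain j where j: "j \<in> G''" "a j = Max (a ` G'')" by auto
  have jG: "j \<in> G'" "b j = b0" using j by (auto simp: G''_def)
  have dom: "b k < b0 \<or> (b k = b0 \<and> a k < a j)" if k: "k \<in> G'" "k \<noteq> j" for k
  proof -
    have "b k \<le> b0" using k G' by (auto simp: b0_def)
    moreover have "a k \<le> a j" if "b k = b0"
      using that k G'' j by (auto simp: G''_def)
    moreover have "(a k, b k) \<noteq> (a j, b j)"
      using inj k jG by (auto simp: inj_on_def G'_def)
    ultimately show ?thesis using jG by force
  qed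
  let ?f = "\<lambda>k s. d k * exp (s * (a k - a j) + s\<^sup>2 * (b k - b0))"
  have lim: "(?f k \<longlongrightarrow> (if k = j then d j else 0)) at_top" if k: "k \<in> G'" for k
  proof (cases "k = j")
    case True
    then show ?thesis using jG by simp
  next
    case False
    define u v where "u = a k - a j" and "v = b k - b0"
    have "((\<lambda>s. exp (s * u + s\<^sup>2 * v)) \<longlongrightarrow> 0) at_top"
    proof (cases "v < 0")
      case True
      then show ?thesis by real_asymp
    next
      case v: False
      then have "v = 0" "u < 0" using dom[OF k False] by (auto simp: u_def v_def)
      then show ?thesis by simp real_asymp
    qed
    from tendsto_mult_right_zero[OF this, of "d k"] show ?thesis
      using False by (simp add: u_def v_def)
  qed
  have "((\<lambda>s. \<Sum>k\<in>G'. ?f k s) \<longlongrightarrow> (\<Sum>k\<in>G'. if k = j then d j else 0)) at_top"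
    by (intro tendsto_sum lim)
  then have lim2: "((\<lambda>s. \<Sum>k\<in>G'. ?f k s) \<longlongrightarrow> d j) at_top" using G' jG by simp
  have "(\<Sum>k\<in>G'. ?f k s) = 0" for s
  proof -
    have "(\<Sum>k\<in>G'. ?f k s) = (\<Sum>k\<in>G. ?f k s)"
      using fin by (intro sum.mono_neutral_left) (auto simp: G'_def)
    also have "\<dots> = (\<Sum>k\<in>G. d k * exp (s * a k + s\<^sup>2 * b k) * exp (- (s * a j + s\<^sup>2 * b0)))"
      by (intro sum.cong refl) (simp add: algebra_simps flip: exp_add)
    also have "\<dots> = 0" using zero[of s] by (simp flip: sum_distrib_right)
    finally show ?thesis .
  qed
  then have "d j = 0" using lim2 by (simp add: tendsto_const_iff)
  then show False using jG by (simp add: G'_def)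
qed

text \<open>
  For two distinct Gaussians, the directions in which the means or the variances differ form an open
  set, nonempty by \<open>gaussian_eqI\<close>. It is dense: if \<open>v\<close> belongs to it, then on the line
  \<open>t + r *\<^sub>R v\<close> the difference of the means is affine in \<open>r\<close>, the difference of the variances is
  quadratic in \<open>r\<close>, and one of them is not identically zero, so they cannot both vanish at the three
  points \<open>r = 0\<close>, \<open>r = e\<close> and \<open>r = -e\<close>. Finitely many dense open sets have a common point.
\<close>

lemma separating_direction:
  assumes fin: "finite G" and G: "\<And>M. M \<in> G \<Longrightarrow> gaussian_measure M"
  shows "\<exists>t :: 'a::euclidean_space. inj_on (\<lambda>M. (t \<bullet> mean M, cov M t t)) G"
proof -
  define good :: "'a measure \<times> 'a measure \<Rightarrow> 'a set"
    where "good = (\<lambda>(M, N). {t. t \<bullet> mean M \<noteq> t \<bullet> mean N} \<union> {t. cov M t t \<noteq> cov N t t})"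
  define P where "P = {(M, N). M \<in> G \<and> N \<in> G \<and> M \<noteq> N}"
  have "P \<subseteq> G \<times> G" by (auto simp: P_def)
  then have finP: "finite P" using fin by (meson finite_SigmaI finite_subset)
  have bil: "bilinear (cov M)" if "M \<in> G" for M
    using square_integrable_law.psd_form_cov[OF gaussian_measureD(1)[OF G[OF that]]]
    by (rule psd_form_bilinear)
  have sym: "cov M s t = cov M t s" if "M \<in> G" for M s t
    using square_integrable_law.psd_form_cov[OF gaussian_measureD(1)[OF G[OF that]]]
    by (simp add: psd_form_def)
  have cont: "continuous_on UNIV (\<lambda>t. cov M t t)" if "M \<in> G" for M
    using bilinear_continuous_on_compose[OF continuous_on_id continuous_on_id bil[OF that]] .
  have "UNIV \<subseteq> closure (\<Inter>(good ` P))"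
  proof (rule Baire)
    show "closed (UNIV :: 'a set)" "countable (good ` P)" using finP by (auto intro: countable_finite)
    fix T assume "T \<in> good ` P"
    then obtain M N where MN: "M \<in> G" "N \<in> G" "M \<noteq> N" and T: "T = good (M, N)" by (auto simp: P_def)
    have "open T" unfolding T good_def prod.case
      by (intro open_Un open_Collect_neq continuous_intros cont MN)
    moreover have "t \<in> closure T" for t
    proof -
      obtain v where v: "v \<in> T"
        using gaussian_eqI[of M N] MN G by (force simp: T good_def intro: euclidean_eqI simp: inner_commute vector_eq_ldot)
      have line: "t \<in> T \<or> t + e *\<^sub>R v \<in> T \<or> t - e *\<^sub>R v \<in> T" if "e > 0" for e
      proof (rule ccontr)
        assume "\<not> ?thesis"
        then have m: "t \<bullet> mean M = t \<bullet> mean N" "(t + e *\<^sub>R v) \<bullet> mean M = (t + e *\<^sub>R v) \<bullet> mean N"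
          and c: "cov M t t = cov N t t" "cov M (t + e *\<^sub>R v) (t + e *\<^sub>R v) = cov N (t + e *\<^sub>R v) (t + e *\<^sub>R v)"
            "cov M (t - e *\<^sub>R v) (t - e *\<^sub>R v) = cov N (t - e *\<^sub>R v) (t - e *\<^sub>R v)"
          by (auto simp: T good_def)
        have ex: "cov L (t + r *\<^sub>R v) (t + r *\<^sub>R v) = cov L t t + 2 * r * cov L t v + r\<^sup>2 * cov L v v"
          if "L \<in> G" for L r
          using sym[OF that, of v t]
          by (simp add: bilinear_ladd[OF bil[OF that]] bilinear_radd[OF bil[OF that]]
              bilinear_lmul[OF bil[OF that]] bilinear_rmul[OF bil[OF that]] algebra_simps power2_eq_square)
        have "v \<bullet> mean M = v \<bullet> mean N" using m that by (simp add: inner_add_left)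
        moreover have "e\<^sup>2 * cov M v v = e\<^sup>2 * cov N v v"
          using c ex[OF MN(1), of e] ex[OF MN(2), of e]
            ex[OF MN(1), of "-e", simplified] ex[OF MN(2), of "-e", simplified]
          by linarith
        ultimately show False using v that by (simp add: T good_def)
      qed
      show "t \<in> closure T"
        unfolding closure_approachable
      proof (intro allI impI)
        fix e :: real assume "e > 0"
        define r where "r = e / (2 * (norm v + 1))"
        have r: "r > 0" using \<open>e > 0\<close> norm_ge_zero[of v] by (simp add: r_def add_nonneg_pos)
        have "r * norm v < e"
          using \<open>e > 0\<close> norm_ge_zero[of v] by (simp add: r_def field_simps add_nonneg_pos add_pos_nonneg)
        then have "dist (t + r *\<^sub>R v) t < e" "dist (t - r *\<^sub>R v) t < e" "dist t t < e"
          using r \<open>e > 0\<close> by (simp_all add: dist_norm)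
        then show "\<exists>y\<in>T. dist y t < e" using line[OF r] by blast
      qed
    qed
    ultimately show "openin (top_of_set UNIV) T \<and> UNIV \<subseteq> closure T" by auto
  qed
  then have "\<Inter>(good ` P) \<noteq> {}" by auto
  then obtain t where "\<And>M N. (M, N) \<in> P \<Longrightarrow> t \<in> good (M, N)" by blast
  then show ?thesis by (intro exI[of _ t]) (force simp: inj_on_def P_def good_def)
qed

lemma laplace_gaussian_mixture:
  fixes \<nu> :: "'i \<Rightarrow> 'a::euclidean_space measure"
  assumes "finite I" "\<And>i. i \<in> I \<Longrightarrow> gaussian_measure (\<nu> i)" "\<And>i. i \<in> I \<Longrightarrow> 0 \<le> p i"
  shows "(\<integral>\<^sup>+x. ennreal (exp (s * (t \<bullet> x))) \<partial>mixture I p \<nu>)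
    = ennreal (\<Sum>i\<in>I. p i * exp (s * (t \<bullet> mean (\<nu> i)) + s\<^sup>2 * (cov (\<nu> i) t t / 2)))"
  using assms
  by (subst nn_integral_mixture)
    (simp_all add: gaussian_sets laplace_gaussian sum_ennreal[symmetric] ennreal_mult' del: sum_ennreal)

lemma sum_group_image:
  fixes w :: "'i \<Rightarrow> real"
  assumes "finite I" "finite G" "\<theta> ` I \<subseteq> G"
  shows "(\<Sum>i\<in>I. w i * E (\<theta> i)) = (\<Sum>M\<in>G. (\<Sum>i | i \<in> I \<and> \<theta> i = M. w i) * E M)"
  using sum.group[OF assms, of "\<lambda>i. w i * E (\<theta> i)"]
  by (simp add: sum_distrib_right)

text \<open>
  Equal components may occur with different indices, so what a mixture determines is the total weight
  \<open>d\<close> that it gives to each Gaussian. Along a separating direction the differences of these total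
  weights are the coefficients of a vanishing combination of independent exponentials.
\<close>

theorem gaussian_mixture_identifiable:
  fixes \<nu> :: "'i \<Rightarrow> 'a::euclidean_space measure" and \<rho> :: "'l \<Rightarrow> 'a measure"
  assumes fin: "finite I" "finite L"
    and \<nu>: "\<And>i. i \<in> I \<Longrightarrow> gaussian_measure (\<nu> i)" "\<And>i. i \<in> I \<Longrightarrow> 0 \<le> p i"
    and \<rho>: "\<And>l. l \<in> L \<Longrightarrow> gaussian_measure (\<rho> l)" "\<And>l. l \<in> L \<Longrightarrow> 0 \<le> q l"
    and eq: "mixture I p \<nu> = mixture L q \<rho>"
  shows "(\<Sum>i | i \<in> I \<and> \<nu> i = H. p i) = (\<Sum>l | l \<in> L \<and> \<rho> l = H. q l)"
proof -
  define G where "G = \<nu> ` I \<union> \<rho> ` L"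
  have G: "finite G" "\<And>M. M \<in> G \<Longrightarrow> gaussian_measure M" using fin \<nu> \<rho> by (auto simp: G_def)
  obtain t where t: "inj_on (\<lambda>M. (t \<bullet> mean M, cov M t t)) G" using separating_direction[OF G] by blast
  define E where "E = (\<lambda>s M. exp (s * (t \<bullet> mean M) + s\<^sup>2 * (cov M t t / 2)))"
  define d where "d = (\<lambda>M. (\<Sum>i | i \<in> I \<and> \<nu> i = M. p i) - (\<Sum>l | l \<in> L \<and> \<rho> l = M. q l))"
  have "d M = 0" if "M \<in> G" for M
  proof (rule exp_quadratic_linear_independent[OF G(1) _ _ that])
    show "inj_on (\<lambda>M. (t \<bullet> mean M, cov M t t / 2)) G" using t by (auto simp: inj_on_def)
    fix s
    have "ennreal (\<Sum>i\<in>I. p i * E s (\<nu> i)) = ennreal (\<Sum>l\<in>L. q l * E s (\<rho> l))"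
      using laplace_gaussian_mixture[of I \<nu> p s t] laplace_gaussian_mixture[of L \<rho> q s t] fin \<nu> \<rho> eq
      by (simp add: E_def)
    then have "(\<Sum>i\<in>I. p i * E s (\<nu> i)) = (\<Sum>l\<in>L. q l * E s (\<rho> l))"
      using \<nu> \<rho> by (subst (asm) ennreal_inj) (auto intro!: sum_nonneg simp: E_def)
    then have "(\<Sum>M\<in>G. d M * E s M) = 0"
      using sum_group_image[of I G \<nu> p "E s"] sum_group_image[of L G \<rho> q "E s"] fin G(1)
      by (simp add: G_def d_def left_diff_distrib sum_subtractf)
    then show "(\<Sum>M\<in>G. d M * exp (s * (t \<bullet> mean M) + s\<^sup>2 * (cov M t t / 2))) = 0"
      by (simp add: E_def)
  qed
  then show ?thesis
  proof (cases "H \<in> G")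
    case False
    then have "{i. i \<in> I \<and> \<nu> i = H} = {}" "{l. l \<in> L \<and> \<rho> l = H} = {}" by (auto simp: G_def)
    then show ?thesis by (simp only: sum.empty)
  qed (simp add: d_def)
qed

section \<open>Gaussian measures with prescribed mean and covariance\<close>

lemma psd_form_expand:
  assumes "psd_form q"
  shows "q s t = (\<Sum>b\<in>Basis. (s \<bullet> b) * q b t)"
proof -
  have lin: "linear (\<lambda>x. q x t)" by (intro linearI) (simp_all add: psd_formD[OF assms])
  have "q s t = q (\<Sum>b\<in>Basis. (s \<bullet> b) *\<^sub>R b) t" by (simp add: euclidean_representation)
  also have "\<dots> = (\<Sum>b\<in>Basis. (s \<bullet> b) * q b t)"
    using linear_sum[OF lin, of "\<lambda>b. (s \<bullet> b) *\<^sub>R b" Basis] by (simp add: psd_formD[OF assms])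
  finally show ?thesis .
qed

text \<open>
  The Cauchy--Schwarz inequality in its degenerate case.
\<close>

lemma psd_form_radical:
  assumes q: "psd_form q" and b: "q b b = 0"
  shows "q b t = 0"
proof (rule ccontr)
  assume n: "q b t \<noteq> 0"
  \<comment> \<open>With this \<open>c\<close> the form would take the value \<open>-1\<close> at \<open>t + c *\<^sub>R b\<close>.\<close>
  define c where "c = - (q t t + 1) / (2 * q b t)"
  have "0 \<le> q (t + c *\<^sub>R b) (t + c *\<^sub>R b)" by (rule psd_formD(6)[OF q])
  also have "\<dots> = q t t + 2 * c * q b t"
    using b psd_formD(5)[OF q, of t b] by (simp add: psd_formD(1-4)[OF q])
  also have "2 * c * q b t = - (q t t + 1)" using n by (simp add: c_def field_simps)
  finally show False by simp
qed

text \<open>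
  This is the Cholesky decomposition without coordinates. Subtracting the rank one form
  \<open>q s b * q t b / q b b\<close> from \<open>q\<close> leaves a positive semidefinite form that has \<open>b\<close> in its radical;
  if \<open>q b b = 0\<close>, then \<open>b\<close> is in the radical already. The induction is over the set \<open>B\<close> of basis
  vectors that may lie outside the radical.
\<close>

lemma psd_form_factor:
  fixes q :: "'a::euclidean_space \<Rightarrow> 'a \<Rightarrow> real"
  assumes "psd_form q"
  shows "\<exists>a :: 'a \<Rightarrow> 'a. \<forall>s t. q s t = (\<Sum>b\<in>Basis. (s \<bullet> a b) * (t \<bullet> a b))"
proof -
  have "\<exists>a :: 'a \<Rightarrow> 'a. \<forall>s t. q s t = (\<Sum>b\<in>B. (s \<bullet> a b) * (t \<bullet> a b))"
    if "finite B" "B \<subseteq> Basis" "psd_form q" "\<And>b t. b \<in> Basis - B \<Longrightarrow> q b t = 0"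
    for B :: "'a set" and q
    using that
  proof (induction B arbitrary: q)
    case empty
    then have "q s t = 0" for s t by (subst psd_form_expand) auto
    then show ?case by simp
  next
    case (insert b B)
    note q = \<open>psd_form q\<close>
    note lin = psd_formD(1-4)[OF q]
    show ?case
    proof (cases "q b b = 0")
      case True
      then have "q c t = 0" if "c \<in> Basis - B" for c t
        using insert.prems(3) that psd_form_radical[OF q True] by (cases "c = b") auto
      then obtain a where "\<And>s t. q s t = (\<Sum>b\<in>B. (s \<bullet> a b) * (t \<bullet> a b))"
        using insert.IH[OF _ q] insert.prems by blast
      then have "q s t = (\<Sum>c\<in>insert b B. (s \<bullet> (a(b := 0)) c) * (t \<bullet> (a(b := 0)) c))" for s t
        using insert.hyps by (auto intro!: sum.cong)
      then show ?thesis by blast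
    next
      case False
      then have pos: "q b b > 0" using psd_formD(6)[OF q, of b] by simp
      define q' where "q' = (\<lambda>s t. q s t - q s b * q t b / q b b)"
      have "0 \<le> q' t t" for t
      proof -
        have "q' t t = q (t + (- (q t b / q b b)) *\<^sub>R b) (t + (- (q t b / q b b)) *\<^sub>R b)"
          unfolding lin q'_def using pos psd_formD(5)[OF q, of b t] by (simp add: field_simps)
        then show ?thesis using psd_formD(6)[OF q] by simp
      qed
      then have q': "psd_form q'"
        unfolding psd_form_def q'_def using pos psd_formD(5)[OF q]
        by (auto simp: lin field_simps)
      have "q' c t = 0" if "c \<in> Basis - B" for c t
        using that insert.prems(3)[of c] pos psd_formD(5)[OF q, of t b]
        by (cases "c = b") (simp_all add: q'_def)
      then obtain a where a: "\<And>s t. q' s t = (\<Sum>b\<in>B. (s \<bullet> a b) * (t \<bullet> a b))"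
        using insert.IH[OF _ q'] insert.prems by blast
      \<comment> \<open>\<open>v\<close> represents the linear functional \<open>\<lambda>s. q s b / sqrt (q b b)\<close>, whose square is the
        form that was subtracted.\<close>
      define v where "v = (\<Sum>c\<in>Basis. (q c b / sqrt (q b b)) *\<^sub>R c)"
      have v: "s \<bullet> v = q s b / sqrt (q b b)" for s
        by (subst psd_form_expand[OF q]) (simp add: v_def inner_sum_right sum_divide_distrib mult.commute)
      have "q s t = (\<Sum>c\<in>insert b B. (s \<bullet> (a(b := v)) c) * (t \<bullet> (a(b := v)) c))" for s t
      proof -
        have "(\<Sum>c\<in>B. (s \<bullet> (a(b := v)) c) * (t \<bullet> (a(b := v)) c)) = q' s t"
          unfolding a using insert.hyps by (intro sum.cong) auto
        then show ?thesis using insert.hyps pos by (simp add: v q'_def)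
      qed
      then show ?thesis by blast
    qed
  qed
  from this[OF finite_Basis order_refl assms] show ?thesis by simp
qed

lemma normal_law_sum:
  fixes c :: "'i \<Rightarrow> real"
  assumes "finite I"
  shows "distr (Pi\<^sub>M I (\<lambda>_. std_normal_distribution)) borel (\<lambda>\<omega>. m + (\<Sum>i\<in>I. \<omega> i * c i))
    = normal_law m (sqrt (\<Sum>i\<in>I. (c i)\<^sup>2))"
    (is "distr ?W borel ?f = _")
proof (rule Levy_uniqueness)
  interpret N: real_distribution std_normal_distribution by (rule real_dist_normal_dist)
  interpret P: product_prob_space "\<lambda>_. std_normal_distribution" I ..
  interpret F: finite_product_prob_space "\<lambda>_. std_normal_distribution" I using assms by unfold_locales
  have fm: "?f \<in> borel_measurable ?W"
    by (intro borel_measurable_add borel_measurable_sum borel_measurable_times borel_measurable_const)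
      (auto intro!: measurable_compose[OF measurable_component_singleton])
  show "real_distribution (distr ?W borel ?f)" using fm by (rule P.real_distribution_distr)
  show "real_distribution (normal_law m (sqrt (\<Sum>i\<in>I. (c i)\<^sup>2)))"
    by (intro real_distribution_normal_law real_sqrt_ge_zero sum_nonneg) simp
  show "char (distr ?W borel ?f) = char (normal_law m (sqrt (\<Sum>i\<in>I. (c i)\<^sup>2)))"
  proof
    fix t
    have "char (distr ?W borel ?f) t = (CLINT \<omega>|?W. iexp (t * ?f \<omega>))"
      unfolding char_def using fm by (subst integral_distr) auto
    also have "\<dots> = (CLINT \<omega>|?W. iexp (t * m) * (\<Prod>i\<in>I. iexp (t * c i * \<omega> i)))"
      by (intro Bochner_Integration.integral_cong refl)
        (simp add: exp_sum[OF assms, symmetric] exp_add[symmetric] sum_distrib_left algebra_simps)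
    also have "\<dots> = iexp (t * m) * (CLINT \<omega>|?W. (\<Prod>i\<in>I. iexp (t * c i * \<omega> i)))"
      by (rule integral_mult_right_zero)
    also have "(CLINT \<omega>|?W. (\<Prod>i\<in>I. iexp (t * c i * \<omega> i)))
        = (\<Prod>i\<in>I. CLINT x|std_normal_distribution. iexp (t * c i * x))"
      using assms by (intro P.product_integral_prod) (auto intro!: N.integrable_iexp)
    also have "\<dots> = (\<Prod>i\<in>I. exp (- ((t * c i)\<^sup>2) / 2))"
    proof -
      have "(CLINT x|std_normal_distribution. iexp (u * x)) = exp (- (u\<^sup>2) / 2)" for u :: real
        using fun_cong[OF char_std_normal_distribution, of u] by (simp add: char_def)
      then show ?thesis by (simp only: of_real_prod)
    qed
    also have "(\<Prod>i\<in>I. exp (- ((t * c i)\<^sup>2) / 2)) = exp (- (t * sqrt (\<Sum>i\<in>I. (c i)\<^sup>2))\<^sup>2 / 2)"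
      by (simp add: exp_sum[OF assms, symmetric] power_mult_distrib sum_nonneg sum_distrib_left
          sum_divide_distrib sum_negf)
    finally show "char (distr ?W borel ?f) t = char (normal_law m (sqrt (\<Sum>i\<in>I. (c i)\<^sup>2))) t"
      by (simp add: char_normal_law sum_nonneg)
  qed
qed

lemma psd_form_polarization:
  assumes "psd_form q"
  shows "q s t = (q (s + t) (s + t) - q s s - q t t) / 2"
  using psd_formD(5)[OF assms, of t s] by (simp add: psd_formD(1-4)[OF assms])

text \<open>
  The vectors of \<open>psd_form_factor\<close> serve as the columns of a square root of the covariance: the
  measure is the image of a standard normal vector under an affine map.
\<close>

theorem gaussian_exists:
  fixes q :: "'a::euclidean_space \<Rightarrow> 'a \<Rightarrow> real"
  assumes q: "psd_form q"
  shows "\<exists>M. gaussian_measure M \<and> mean M = m \<and> cov M = q"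
proof -
  obtain a :: "'a \<Rightarrow> 'a" where a: "\<And>s t. q s t = (\<Sum>b\<in>Basis. (s \<bullet> a b) * (t \<bullet> a b))"
    using psd_form_factor[OF q] by blast
  let ?W = "Pi\<^sub>M Basis (\<lambda>_::'a. std_normal_distribution)"
  let ?f = "\<lambda>\<omega>. m + (\<Sum>b\<in>Basis. \<omega> b *\<^sub>R a b)"
  define M where "M = distr ?W borel ?f"
  have fm [measurable]: "?f \<in> borel_measurable ?W"
    by (intro borel_measurable_add borel_measurable_sum borel_measurable_scaleR borel_measurable_const)
      (auto intro!: measurable_compose[OF measurable_component_singleton])
  have law: "distr M borel (\<lambda>x. t \<bullet> x) = normal_law (t \<bullet> m) (sqrt (q t t))" for t
  proof -
    have "distr M borel (\<lambda>x. t \<bullet> x) = distr ?W borel (\<lambda>\<omega>. t \<bullet> m + (\<Sum>b\<in>Basis. \<omega> b * (t \<bullet> a b)))"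
      unfolding M_def by (subst distr_distr) (auto simp: o_def inner_add_right inner_sum_right)
    then show ?thesis by (simp add: normal_law_sum a power2_eq_square)
  qed
  have q0: "0 \<le> q t t" for t by (rule psd_formD(6)[OF q])
  have G: "gaussian_measure M"
    unfolding gaussian_measure_def
  proof (intro conjI allI exI)
    show "distr M borel (\<lambda>x. t \<bullet> x) = normal_law (t \<bullet> m) (sqrt (q t t))" for t by (rule law)
    show "0 \<le> sqrt (q t t)" for t using q0 by simp
  qed (simp add: M_def)
  interpret square_integrable_law M using G by (rule gaussian_measureD)
  have m: "t \<bullet> mean M = t \<bullet> m" and v: "(t \<bullet> mean M)\<^sup>2 + cov M t t = (t \<bullet> m)\<^sup>2 + q t t" for t
  proof -
    have "normal_law (t \<bullet> mean M) (sqrt (cov M t t)) = normal_law (t \<bullet> m) (sqrt (q t t))"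
      using law gaussian_measureD(2)[OF G] by simp
    then show "t \<bullet> mean M = t \<bullet> m" "(t \<bullet> mean M)\<^sup>2 + cov M t t = (t \<bullet> m)\<^sup>2 + q t t"
      using normal_law_moments(2,4)[of "sqrt (q t t)" "t \<bullet> m"] q0
        normal_law_moments(2,4)[of "sqrt (cov M t t)" "t \<bullet> mean M"] psd_formD(6)[OF psd_form_cov]
      by simp_all
  qed
  have "mean M = m" using m vector_eq_ldot by blast
  moreover have "cov M = q"
  proof (intro ext)
    fix s t
    have eq: "cov M t t = q t t" for t using m[of t] v[of t] by simp
    show "cov M s t = q s t"
      unfolding psd_form_polarization[OF q, of s t] psd_form_polarization[OF psd_form_cov, of s t] eq ..
  qed
  ultimately show ?thesis using G by blast
qed

section \<open>Gaussian optimal plans between Gaussian marginals\<close>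

lemma integrable_mult_if_square:
  fixes f g :: "'a \<Rightarrow> real"
  assumes [measurable]: "f \<in> borel_measurable M" "g \<in> borel_measurable M"
    and "integrable M (\<lambda>x. (f x)\<^sup>2)" "integrable M (\<lambda>x. (g x)\<^sup>2)"
  shows "integrable M (\<lambda>x. f x * g x)"
proof (rule Bochner_Integration.integrable_bound)
  show "integrable M (\<lambda>x. (f x)\<^sup>2 + (g x)\<^sup>2)" using assms by simp
  have "\<bar>a * b\<bar> \<le> a\<^sup>2 + b\<^sup>2" for a b :: real
  proof -
    have "2 * (\<bar>a\<bar> * \<bar>b\<bar>) \<le> a\<^sup>2 + b\<^sup>2" "0 \<le> \<bar>a\<bar> * \<bar>b\<bar>"
      using sum_squares_bound[of "\<bar>a\<bar>" "\<bar>b\<bar>"] by simp_all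
    then show ?thesis unfolding abs_mult by linarith
  qed
  then show "AE x in M. norm (f x * g x) \<le> norm ((f x)\<^sup>2 + (g x)\<^sup>2)" by simp
qed simp

lemma borel_measurable_vec_nth [measurable]:
  "(\<lambda>x :: 'a::euclidean_space ^ 'j::finite. x $ j) \<in> borel_measurable borel"
  by (intro borel_measurable_continuous_onI continuous_intros)

lemma mean_cov_marginal:
  fixes \<gamma> :: "('a::euclidean_space ^ 'j::finite) measure"
  assumes "square_integrable_law \<gamma>"
  shows "mean (distr \<gamma> borel (\<lambda>x. x $ j)) = mean \<gamma> $ j"
    and "cov (distr \<gamma> borel (\<lambda>x. x $ j)) u v = cov \<gamma> (axis j u) (axis j v)"
proof -
  interpret square_integrable_law \<gamma> by fact
  let ?D = "distr \<gamma> borel (\<lambda>x. x $ j)"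
  interpret D: square_integrable_law ?D
  proof -
    interpret D: prob_space ?D by (rule prob_space_distr) simp
    show "square_integrable_law ?D"
    proof
      show "integrable ?D (\<lambda>x. (t \<bullet> x)\<^sup>2)" for t
        using integrable_inner_square[of "axis j t"] by (simp add: integrable_distr_eq inner_axis')
    qed simp
  qed
  have "u \<bullet> mean ?D = u \<bullet> (mean \<gamma> $ j)" for u
    using inner_mean[of "axis j u"] D.inner_mean[of u] by (simp add: integral_distr inner_axis')
  then show m: "mean ?D = mean \<gamma> $ j" using vector_eq_ldot by blast
  show "cov ?D u v = cov \<gamma> (axis j u) (axis j v)"
    unfolding cov_def m by (subst integral_distr) (auto simp: inner_axis')
qed

lemma coupling_square_integrable:
  fixes \<gamma> :: "('a::euclidean_space ^ 'j::finite) measure"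
  assumes \<gamma>: "\<gamma> \<in> couplings \<nu>" and \<nu>: "\<And>j. square_integrable_law (\<nu> j)"
  shows "square_integrable_law \<gamma>"
proof -
  interpret prob_space \<gamma> using \<gamma> by (simp add: couplings_def)
  have s [measurable_cong]: "sets \<gamma> = sets borel" and d: "distr \<gamma> borel (\<lambda>x. x $ j) = \<nu> j" for j
    using \<gamma> by (auto simp: couplings_def)
  have sq: "integrable \<gamma> (\<lambda>x. (u \<bullet> (x $ j))\<^sup>2)" for u j
  proof -
    have "integrable (distr \<gamma> borel (\<lambda>x. x $ j)) (\<lambda>x. (u \<bullet> x)\<^sup>2)"
      unfolding d using \<nu> by (rule square_integrable_law.integrable_inner_square)
    then show ?thesis by (simp add: integrable_distr_eq)
  qed
  show ?thesis
  proof
    show "integrable \<gamma> (\<lambda>x. (t \<bullet> x)\<^sup>2)" for t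
      unfolding inner_vec_def power2_eq_square sum_product
      by (intro Bochner_Integration.integrable_sum integrable_mult_if_square sq) measurable
  qed (rule s)
qed

text \<open>
  The candidates for the covariance of a coupling: each marginal prescribes one diagonal block, and
  the cross covariances are restricted by semidefiniteness only.
\<close>

definition coupling_forms ::
    "('j::finite \<Rightarrow> 'a::euclidean_space measure) \<Rightarrow> ('a ^ 'j \<Rightarrow> 'a ^ 'j \<Rightarrow> real) set" where
  "coupling_forms \<nu> = {q. psd_form q \<and> (\<forall>j u v. q (axis j u) (axis j v) = cov (\<nu> j) u v)}"

lemma mean_cov_coupling:
  fixes \<gamma> :: "('a::euclidean_space ^ 'j::finite) measure"
  assumes \<gamma>: "\<gamma> \<in> couplings \<nu>" and \<nu>: "\<And>j. square_integrable_law (\<nu> j)"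
  shows "mean \<gamma> = (\<chi> j. mean (\<nu> j))" "cov \<gamma> \<in> coupling_forms \<nu>"
proof -
  have sq: "square_integrable_law \<gamma>" using assms by (rule coupling_square_integrable)
  have d: "distr \<gamma> borel (\<lambda>x. x $ j) = \<nu> j" for j using \<gamma> by (auto simp: couplings_def)
  show "mean \<gamma> = (\<chi> j. mean (\<nu> j))"
    using mean_cov_marginal(1)[OF sq] by (simp add: d vec_eq_iff)
  show "cov \<gamma> \<in> coupling_forms \<nu>"
    using mean_cov_marginal(2)[OF sq] square_integrable_law.psd_form_cov[OF sq]
    by (simp add: d coupling_forms_def)
qed

text \<open>
  The marginals of the Gaussian with covariance \<open>q\<close> are Gaussians with the same means and
  covariances as the \<open>\<nu> j\<close>, hence equal to them.
\<close>

lemma gaussian_coupling_exists: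
  fixes \<nu> :: "'j::finite \<Rightarrow> 'a::euclidean_space measure"
  assumes \<nu>: "\<And>j. gaussian_measure (\<nu> j)" and q: "q \<in> coupling_forms \<nu>"
  shows "\<exists>\<gamma>. gaussian_measure \<gamma> \<and> \<gamma> \<in> couplings \<nu> \<and> cov \<gamma> = q"
proof -
  obtain \<gamma> where \<gamma>: "gaussian_measure \<gamma>" "mean \<gamma> = (\<chi> j. mean (\<nu> j))" "cov \<gamma> = q"
    using q gaussian_exists[of q "\<chi> j. mean (\<nu> j)"] by (auto simp: coupling_forms_def)
  have sq: "square_integrable_law \<gamma>" using \<gamma>(1) by (rule gaussian_measureD)
  have "distr \<gamma> borel (\<lambda>x. x $ j) = \<nu> j" for j
  proof (rule gaussian_eqI)
    have "linear (\<lambda>x :: 'a ^ 'j. x $ j)" by (intro linearI) simp_all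
    then show "gaussian_measure (distr \<gamma> borel (\<lambda>x. x $ j))"
      using \<gamma>(1) by (intro gaussian_distr_linear)
    show "mean (distr \<gamma> borel (\<lambda>x. x $ j)) = mean (\<nu> j)"
      by (simp add: mean_cov_marginal(1)[OF sq] \<gamma>)
    show "cov (distr \<gamma> borel (\<lambda>x. x $ j)) t t = cov (\<nu> j) t t" for t
      using q by (simp add: mean_cov_marginal(2)[OF sq] \<gamma> coupling_forms_def)
  qed (rule \<nu>)
  then have "\<gamma> \<in> couplings \<nu>"
    using gaussian_prob[OF \<gamma>(1)] gaussian_sets[OF \<gamma>(1)] by (simp add: couplings_def)
  then show ?thesis using \<gamma> by blast
qed

text \<open>
  Inner products with \<open>deviation lam i u\<close> read off the \<open>u\<close>-component of \<open>x\<^sub>i - B(x)\<close>. The cost thus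
  becomes a sum of squares of linear functionals, whose integrals are second moments.
\<close>

definition deviation :: "('j::finite \<Rightarrow> real) \<Rightarrow> 'j \<Rightarrow> 'a::euclidean_space \<Rightarrow> 'a ^ 'j" where
  "deviation lam i u = axis i u - (\<Sum>j\<in>UNIV. lam j *\<^sub>R axis j u)"

lemma mm_cost_deviation:
  "mm_cost lam x = (\<Sum>i\<in>UNIV. \<Sum>u\<in>Basis. lam i * (deviation lam i u \<bullet> x)\<^sup>2)"
proof -
  have "deviation lam i u \<bullet> x = u \<bullet> (x $ i - barycenter lam x)" for i u
    by (simp add: deviation_def barycenter_def inner_diff_left inner_diff_right inner_sum_left
        inner_sum_right inner_axis')
  then show ?thesis
    unfolding mm_cost_def power2_norm_eq_inner
    by (subst euclidean_inner) (simp add: sum_distrib_left power2_eq_square inner_commute)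
qed

lemma plan_cost_eq_cov:
  fixes \<gamma> :: "('a::euclidean_space ^ 'j::finite) measure"
  assumes \<gamma>: "square_integrable_law \<gamma>" and lam: "\<And>j. 0 \<le> lam j"
  shows "plan_cost lam \<gamma> = ennreal (\<Sum>i\<in>UNIV. \<Sum>u\<in>Basis. lam i *
    (cov \<gamma> (deviation lam i u) (deviation lam i u) + (deviation lam i u \<bullet> mean \<gamma>)\<^sup>2))"
proof -
  interpret square_integrable_law \<gamma> by fact
  have "plan_cost lam \<gamma> = ennreal (\<integral>x. mm_cost lam x \<partial>\<gamma>)"
    unfolding plan_cost_def
    by (intro nn_integral_eq_integral)
      (auto simp: mm_cost_deviation integrable_inner_square lam intro!: sum_nonneg)
  also have "(\<integral>x. mm_cost lam x \<partial>\<gamma>) = (\<Sum>i\<in>UNIV. \<Sum>u\<in>Basis. lam i * (\<integral>x. (deviation lam i u \<bullet> x)\<^sup>2 \<partial>\<gamma>))"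
    unfolding mm_cost_deviation
    by (simp add: integrable_inner_square)
  finally show ?thesis by (simp add: second_moment)
qed

lemma compact_PiE_UNIV:
  fixes B :: "'i \<Rightarrow> 'b::topological_space set"
  assumes "\<And>i. compact (B i)"
  shows "compact (PiE UNIV B)"
proof -
  have "compactin (product_topology (\<lambda>i. euclidean) UNIV) (PiE UNIV B)"
    using assms by (simp add: compactin_PiE)
  then show ?thesis by (simp add: euclidean_product_topology)
qed

lemma psd_form_bound:
  assumes "psd_form q"
  shows "\<bar>q s t\<bar> \<le> (q s s + q t t) / 2"
  using psd_formD(6)[OF assms, of "s + t"] psd_formD(6)[OF assms, of "s + (- 1) *\<^sub>R t"]
    psd_formD(5)[OF assms, of t s]
  unfolding psd_formD(1-4)[OF assms] by (simp add: abs_le_iff)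

text \<open>
  By semidefiniteness the cross terms are controlled by the diagonal blocks, which are prescribed.
  The bound is therefore uniform over all candidate forms.
\<close>

lemma coupling_form_bound:
  fixes q :: "'a::euclidean_space ^ 'j::finite \<Rightarrow> 'a ^ 'j \<Rightarrow> real"
  assumes q: "q \<in> coupling_forms \<nu>"
  shows "q s s \<le> real CARD('j) * (\<Sum>j\<in>UNIV. cov (\<nu> j) (s $ j) (s $ j))"
proof -
  have psd: "psd_form q" and blk: "\<And>j u v. q (axis j u) (axis j v) = cov (\<nu> j) u v"
    using q by (auto simp: coupling_forms_def)
  let ?c = "\<lambda>j. cov (\<nu> j) (s $ j) (s $ j)"
  have s: "s = (\<Sum>j\<in>UNIV. axis j (s $ j))"
    by (simp add: vec_eq_iff axis_def if_distrib[where f="\<lambda>v. v $ _"] cong: if_cong)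
  have "q s s = (\<Sum>i\<in>UNIV. \<Sum>j\<in>UNIV. q (axis i (s $ i)) (axis j (s $ j)))"
    using bilinear_sum[OF psd_form_bilinear[OF psd], of "\<lambda>j. axis j (s $ j)" UNIV "\<lambda>j. axis j (s $ j)" UNIV]
    by (simp add: s[symmetric] sum.cartesian_product)
  also have "\<dots> \<le> (\<Sum>i\<in>UNIV. \<Sum>j\<in>(UNIV :: 'j set). (?c i + ?c j) / 2)"
  proof (intro sum_mono)
    fix i j
    show "q (axis i (s $ i)) (axis j (s $ j)) \<le> (?c i + ?c j) / 2"
      using psd_form_bound[OF psd, of "axis i (s $ i)" "axis j (s $ j)"] unfolding blk by linarith
  qed
  also have "\<dots> = real CARD('j) * (\<Sum>j\<in>UNIV. ?c j)"
    by (simp add: sum.distrib add_divide_distrib flip: sum_distrib_left sum_divide_distrib)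
  finally show ?thesis .
qed

text \<open>
  As functions on pairs of vectors the forms carry the topology of pointwise convergence. Each of
  the defining conditions involves finitely many values and is closed, and the uniform bound puts
  the set into a product of compact intervals, so Tychonoff's theorem applies.
\<close>

lemma compact_coupling_forms:
  fixes \<nu> :: "'j::finite \<Rightarrow> 'a::euclidean_space measure"
  shows "compact {f. curry f \<in> coupling_forms \<nu>}"
proof -
  let ?r = "\<lambda>s. real CARD('j) * (\<Sum>j\<in>UNIV. cov (\<nu> j) (s $ j) (s $ j))"
  let ?B = "\<lambda>(s, t). {- ((?r s + ?r t) / 2) .. (?r s + ?r t) / 2}"
  have cl: "closed {f. curry f \<in> coupling_forms \<nu>}"
    unfolding coupling_forms_def psd_form_def mem_Collect_eq curry_conv
    by (intro closed_Collect_conj closed_Collect_all closed_Collect_eq closed_Collect_le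
        continuous_intros continuous_on_product_coordinates)
  have "f (s, t) \<in> ?B (s, t)" if f: "curry f \<in> coupling_forms \<nu>" for f s t
  proof -
    have "\<bar>f (s, t)\<bar> \<le> (f (s, s) + f (t, t)) / 2"
      using psd_form_bound[of "curry f" s t] f by (simp add: coupling_forms_def)
    moreover have "f (s, s) \<le> ?r s" "f (t, t) \<le> ?r t"
      using coupling_form_bound[OF f] by (simp_all add: curry_def)
    moreover have "- ((c + d) / 2) \<le> x \<and> x \<le> (c + d) / 2"
      if "\<bar>x\<bar> \<le> (a + b) / 2" "a \<le> c" "b \<le> d" for a b c d x :: real
      using that unfolding abs_le_iff by argo
    ultimately show ?thesis unfolding prod.case atLeastAtMost_iff by blast
  qed
  then have sub: "{f. curry f \<in> coupling_forms \<nu>} \<subseteq> PiE UNIV ?B"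
    by (auto simp: PiE_iff)
  have "compact (PiE UNIV ?B)" by (rule compact_PiE_UNIV) (auto split: prod.split)
  from compact_Int_closed[OF this cl] show ?thesis using sub by (simp add: Int_absorb1)
qed

text \<open>
  Vanishing cross covariances, as for the independent coupling, are always possible.
\<close>

lemma coupling_forms_nonempty:
  fixes \<nu> :: "'j::finite \<Rightarrow> 'a::euclidean_space measure"
  assumes \<nu>: "\<And>j. square_integrable_law (\<nu> j)"
  shows "(\<lambda>s t. \<Sum>j\<in>UNIV. cov (\<nu> j) (s $ j) (t $ j)) \<in> coupling_forms \<nu>"
proof -
  have psd: "psd_form (cov (\<nu> j))" for j using \<nu> by (rule square_integrable_law.psd_form_cov)
  note D = psd_formD[OF psd]
  have z: "cov (\<nu> j) 0 t = 0" for j t using D(2)[of j 0 0 t] by simp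
  have "(\<Sum>i\<in>UNIV. cov (\<nu> i) (axis j u $ i) (axis j v $ i)) = cov (\<nu> j) u v" for j u v
  proof -
    have "cov (\<nu> i) (axis j u $ i) (axis j v $ i) = (if i = j then cov (\<nu> j) u v else 0)" for i
      by (simp add: axis_def z)
    then show ?thesis by simp
  qed
  moreover have "psd_form (\<lambda>s t :: 'a ^ 'j. \<Sum>j\<in>UNIV. cov (\<nu> j) (s $ j) (t $ j))"
    unfolding psd_form_def
    by (intro conjI allI)
      (simp_all add: D(1,2,6) sum.distrib sum_distrib_left sum_nonneg, (subst D(5), rule refl))
  ultimately show ?thesis by (simp add: coupling_forms_def)
qed

text \<open>
  Replacing a coupling by the Gaussian coupling with the same covariance does not change its cost,
  so it suffices to minimise the cost over the compact set of candidate forms.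
\<close>

theorem optimal_gaussian_plan_exists:
  fixes \<nu> :: "'j::finite \<Rightarrow> 'a::euclidean_space measure"
  assumes \<nu>: "\<And>j. gaussian_measure (\<nu> j)" and lam: "\<And>j. 0 \<le> lam j"
  shows "\<exists>\<gamma>. gaussian_measure \<gamma> \<and> optimal_mm_plan lam \<nu> \<gamma> \<and> plan_cost lam \<gamma> < \<infinity>"
proof -
  have sq: "square_integrable_law (\<nu> j)" for j using \<nu> by (rule gaussian_measureD)
  let ?dev = "deviation lam :: 'j \<Rightarrow> 'a \<Rightarrow> 'a ^ 'j"
  define F where "F = (\<lambda>q :: 'a ^ 'j \<Rightarrow> 'a ^ 'j \<Rightarrow> real. \<Sum>i\<in>UNIV. \<Sum>u\<in>Basis. lam i *
    (q (?dev i u) (?dev i u) + (?dev i u \<bullet> (\<chi> j. mean (\<nu> j)))\<^sup>2))"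
  have cost: "plan_cost lam \<gamma> = ennreal (F (cov \<gamma>))" if "\<gamma> \<in> couplings \<nu>" for \<gamma>
    using plan_cost_eq_cov[where lam = lam, OF coupling_square_integrable[OF that sq] lam]
    by (simp add: F_def mean_cov_coupling(1)[OF that sq])
  have "\<exists>f\<in>{f. curry f \<in> coupling_forms \<nu>}. \<forall>g\<in>{f. curry f \<in> coupling_forms \<nu>}. F (curry f) \<le> F (curry g)"
  proof (rule continuous_attains_inf[OF compact_coupling_forms])
    have "curry (case_prod (\<lambda>s t. \<Sum>j\<in>UNIV. cov (\<nu> j) (s $ j) (t $ j))) \<in> coupling_forms \<nu>"
      using coupling_forms_nonempty[OF sq] by simp
    then show "{f. curry f \<in> coupling_forms \<nu>} \<noteq> {}" by blast
    show "continuous_on {f. curry f \<in> coupling_forms \<nu>} (\<lambda>f. F (curry f))"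
      unfolding F_def curry_conv
      by (intro continuous_intros continuous_on_subset[OF continuous_on_product_coordinates]) auto
  qed
  then obtain f where f: "curry f \<in> coupling_forms \<nu>"
    and min: "\<And>g. curry g \<in> coupling_forms \<nu> \<Longrightarrow> F (curry f) \<le> F (curry g)" by blast
  obtain \<gamma> where \<gamma>: "gaussian_measure \<gamma>" "\<gamma> \<in> couplings \<nu>" "cov \<gamma> = curry f"
    using gaussian_coupling_exists[OF \<nu> f] by blast
  have "plan_cost lam \<gamma> \<le> plan_cost lam \<gamma>'" if "\<gamma>' \<in> couplings \<nu>" for \<gamma>'
    using min[of "case_prod (cov \<gamma>')"] mean_cov_coupling(2)[OF that sq] \<gamma>
    by (simp add: cost that ennreal_leI)
  then have "plan_cost lam \<gamma> = mmW2_sq lam \<nu>"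
    unfolding mmW2_sq_def using \<gamma>(2) by (intro antisym INF_greatest INF_lower) auto
  then have "optimal_mm_plan lam \<nu> \<gamma>" using \<gamma>(2) by (simp add: optimal_mm_plan_def)
  moreover have "plan_cost lam \<gamma> < \<infinity>" by (simp add: cost[OF \<gamma>(2)])
  ultimately show ?thesis using \<gamma>(1) by blast
qed

section \<open>The discrete transport problem\<close>

lemma finite_multi_indices [simp]: "finite (multi_indices (K :: 'j::finite \<Rightarrow> nat))"
  by (simp add: multi_indices_def finite_PiE)

lemma multi_indices_mem: "k \<in> multi_indices K \<Longrightarrow> k j \<in> {1..K j}"
  by (auto simp: multi_indices_def)

lemma sum_multi_indices_prod:
  fixes f :: "'j::finite \<Rightarrow> nat \<Rightarrow> real"
  shows "(\<Sum>k\<in>multi_indices K. \<Prod>i\<in>UNIV. f i (k i)) = (\<Prod>i\<in>UNIV. \<Sum>l=1..K i. f i l)"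
  unfolding multi_indices_def by (rule prod_sum_PiE[symmetric]) auto

text \<open>
  A product of probability vectors has these vectors as its marginals. This serves both for the
  independent tensor and for splitting the mass of a single Gaussian component.
\<close>

lemma sum_multi_indices_prod_slice:
  fixes f :: "'j::finite \<Rightarrow> nat \<Rightarrow> real"
  assumes l: "l \<in> {1..K j}" and one: "\<And>i. (\<Sum>l=1..K i. f i l) = 1"
  shows "(\<Sum>k | k \<in> multi_indices K \<and> k j = l. \<Prod>i\<in>UNIV. f i (k i)) = f j l"
proof -
  let ?g = "\<lambda>i r. if i = j \<and> r \<noteq> l then 0 else f i r"
  have slice: "(\<Prod>i\<in>UNIV. ?g i (k i)) = (if k j = l then \<Prod>i\<in>UNIV. f i (k i) else 0)" for k
  proof (cases "k j = l")
    case True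
    then show ?thesis by (auto intro!: prod.cong)
  next
    case False
    have "(\<Prod>i\<in>UNIV. ?g i (k i)) = 0"
      by (rule prod_zero) (use False in auto)
    then show ?thesis using False by simp
  qed
  have fibre: "(\<Sum>r=1..K i. ?g i r) = (if i = j then f j l else 1)" for i
  proof (cases "i = j")
    case True
    have "(\<Sum>r=1..K j. if r \<noteq> l then 0 else f j r) = (\<Sum>r=1..K j. if r = l then f j r else 0)"
      by (intro sum.cong) auto
    then show ?thesis unfolding True using l by simp
  qed (use one[of i] in simp)
  have "(\<Sum>k | k \<in> multi_indices K \<and> k j = l. \<Prod>i\<in>UNIV. f i (k i))
      = (\<Sum>k\<in>multi_indices K. \<Prod>i\<in>UNIV. ?g i (k i))"
    unfolding slice using sum.inter_filter[of "multi_indices K"] by simp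
  also have "\<dots> = (\<Prod>i\<in>UNIV. \<Sum>r=1..K i. ?g i r)" by (rule sum_multi_indices_prod)
  also have "\<dots> = (\<Prod>i\<in>UNIV. if i = j then f j l else 1)" by (simp only: fibre)
  finally show ?thesis by simp
qed

lemma discrete_coupling_total:
  fixes w :: "('j::finite \<Rightarrow> nat) \<Rightarrow> real"
  assumes w: "w \<in> discrete_couplings K p" and p: "(\<Sum>l=1..K j. p j l) = 1"
  shows "(\<Sum>k\<in>multi_indices K. w k) = 1"
proof -
  have "(\<Sum>k\<in>multi_indices K. w k)
      = (\<Sum>l\<in>{1..K j}. \<Sum>k | k \<in> multi_indices K \<and> k j = l. w k)"
    by (rule sum.group[symmetric]) (auto dest: multi_indices_mem)
  also have "\<dots> = (\<Sum>l=1..K j. p j l)"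
    using w by (intro sum.cong refl) (simp add: discrete_couplings_def)
  finally show ?thesis using p by simp
qed

lemma product_discrete_coupling:
  fixes p :: "'j::finite \<Rightarrow> nat \<Rightarrow> real"
  assumes "\<And>j k. k \<in> {1..K j} \<Longrightarrow> 0 \<le> p j k" "\<And>j. (\<Sum>k=1..K j. p j k) = 1"
  shows "(\<lambda>k. \<Prod>i\<in>UNIV. p i (k i)) \<in> discrete_couplings K p"
proof -
  have "0 \<le> (\<Prod>i\<in>UNIV. p i (k i))" if "k \<in> multi_indices K" for k
    by (intro prod_nonneg assms(1) multi_indices_mem[OF that])
  then show ?thesis
    using sum_multi_indices_prod_slice[of _ K _ p, OF _ assms(2)]
    by (simp add: discrete_couplings_def)
qed

text \<open>
  The discrete cost is linear with finite coefficients, and the admissible tensors form a compact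
  polytope once the irrelevant values outside the multi-indices are set to zero.
\<close>

lemma discrete_solution_exists:
  fixes \<nu> :: "'j::finite \<Rightarrow> nat \<Rightarrow> 'a::euclidean_space measure"
  assumes p0: "\<And>j k. k \<in> {1..K j} \<Longrightarrow> 0 \<le> p j k" and p1: "\<And>j. (\<Sum>k=1..K j. p j k) = 1"
    and fin: "\<And>k. k \<in> multi_indices K \<Longrightarrow> mmW2_sq lam (\<lambda>j. \<nu> j (k j)) < \<infinity>"
  shows "\<exists>w. discrete_solution lam K p \<nu> w"
proof -
  define F where "F = (\<lambda>w. \<Sum>k\<in>multi_indices K. w k * enn2real (mmW2_sq lam (\<lambda>j. \<nu> j (k j))))"
  have F: "discrete_cost lam K \<nu> w = ennreal (F w)" if w: "w \<in> discrete_couplings K p" for w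
  proof -
    have "discrete_cost lam K \<nu> w
        = (\<Sum>k\<in>multi_indices K. ennreal (w k * enn2real (mmW2_sq lam (\<lambda>j. \<nu> j (k j)))))"
      unfolding discrete_cost_def
      using w fin by (intro sum.cong refl) (simp add: discrete_couplings_def ennreal_mult')
    then show ?thesis
      using w by (simp add: F_def discrete_couplings_def)
  qed
  define S where "S = {w. w \<in> discrete_couplings K p \<and> (\<forall>k. k \<notin> multi_indices K \<longrightarrow> w k = 0)}"
  have restrict: "(\<lambda>k. if k \<in> multi_indices K then w k else 0) \<in> S"
    if "w \<in> discrete_couplings K p" for w
  proof -
    have "(\<Sum>k | k \<in> multi_indices K \<and> k j = l. if k \<in> multi_indices K then w k else 0)
        = (\<Sum>k | k \<in> multi_indices K \<and> k j = l. w k)" for j l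
      by (intro sum.cong) auto
    then show ?thesis using that by (simp add: S_def discrete_couplings_def)
  qed
  have cl: "closed S"
    unfolding S_def discrete_couplings_def mem_Collect_eq Ball_def
    by (intro closed_Collect_conj closed_Collect_all closed_Collect_imp closed_Collect_eq
        closed_Collect_le continuous_intros continuous_on_product_coordinates) simp_all
  have "w k \<in> {0..1}" if w: "w \<in> S" for w k
  proof (cases "k \<in> multi_indices K")
    case True
    have "w k \<le> (\<Sum>k\<in>multi_indices K. w k)"
      using w True by (intro member_le_sum) (auto simp: S_def discrete_couplings_def)
    then show ?thesis
      using discrete_coupling_total[of w K p undefined] p1 w True by (auto simp: S_def discrete_couplings_def)
  qed (use w in \<open>simp add: S_def\<close>)
  then have sub: "S \<subseteq> PiE UNIV (\<lambda>_. {0..1})" by (auto simp: PiE_iff)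
  have "compact (PiE UNIV (\<lambda>_. {0..1}) :: (('j \<Rightarrow> nat) \<Rightarrow> real) set)" by (rule compact_PiE_UNIV) simp
  from compact_Int_closed[OF this cl] have "compact S" using sub by (simp add: Int_absorb1)
  moreover have "S \<noteq> {}" using restrict[OF product_discrete_coupling[OF p0 p1]] by auto
  moreover have "continuous_on S F"
    unfolding F_def
    by (intro continuous_intros continuous_on_subset[OF continuous_on_product_coordinates]) auto
  ultimately obtain w where w: "w \<in> S" and min: "\<And>v. v \<in> S \<Longrightarrow> F w \<le> F v"
    using continuous_attains_inf[of S F] by blast
  have "\<not> discrete_cost lam K \<nu> v < discrete_cost lam K \<nu> w" if v: "v \<in> discrete_couplings K p" for v
  proof -
    have "F w \<le> F (\<lambda>k. if k \<in> multi_indices K then v k else 0)" using min[OF restrict[OF v]] .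
    also have "\<dots> = F v" by (simp add: F_def)
    finally show ?thesis using v w by (simp add: F S_def not_less ennreal_leI)
  qed
  then show ?thesis using w by (auto simp: discrete_solution_def is_arg_min_def S_def)
qed

section \<open>Couplings that are Gaussian mixtures\<close>

lemma mixture_of_couplings:
  fixes \<nu> :: "'j::finite \<Rightarrow> nat \<Rightarrow> 'a::euclidean_space measure"
  assumes w: "w \<in> discrete_couplings K p" and p: "\<And>j. (\<Sum>l=1..K j. p j l) = 1"
    and \<gamma>: "\<And>k. k \<in> multi_indices K \<Longrightarrow> \<gamma> k \<in> couplings (\<lambda>j. \<nu> j (k j))"
    and \<nu>: "\<And>j l. l \<in> {1..K j} \<Longrightarrow> sets (\<nu> j l) = sets borel"
  shows "mixture (multi_indices K) w \<gamma> \<in> couplings (\<lambda>j. mixture {1..K j} (p j) (\<nu> j))"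
proof -
  have w0: "\<And>k. k \<in> multi_indices K \<Longrightarrow> 0 \<le> w k" using w by (auto simp: discrete_couplings_def)
  have s: "sets (\<gamma> k) = sets borel" "prob_space (\<gamma> k)"
    and d: "distr (\<gamma> k) borel (\<lambda>x. x $ j) = \<nu> j (k j)"
    if "k \<in> multi_indices K" for k j
    using \<gamma>[OF that] by (auto simp: couplings_def)
  have "distr (mixture (multi_indices K) w \<gamma>) borel (\<lambda>x. x $ j) = mixture {1..K j} (p j) (\<nu> j)" for j
  proof (rule mixture_eqI)
    fix A :: "'a set" assume A: "A \<in> sets borel"
    have "distr (mixture (multi_indices K) w \<gamma>) borel (\<lambda>x. x $ j)
        = mixture (multi_indices K) w (\<lambda>k. distr (\<gamma> k) borel (\<lambda>x. x $ j))"
      using s by (intro distr_mixture) auto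
    also have "emeasure \<dots> A
        = (\<Sum>k\<in>multi_indices K. ennreal (w k) * emeasure (distr (\<gamma> k) borel (\<lambda>x. x $ j)) A)"
      using A by (intro emeasure_mixture) auto
    also have "\<dots> = (\<Sum>k\<in>multi_indices K. ennreal (w k) * emeasure (\<nu> j (k j)) A)"
      by (intro sum.cong refl) (simp add: d)
    also have "\<dots> = (\<Sum>l\<in>{1..K j}. \<Sum>k | k \<in> multi_indices K \<and> k j = l.
        ennreal (w k) * emeasure (\<nu> j (k j)) A)"
      by (rule sum.group[symmetric]) (auto dest: multi_indices_mem)
    also have "\<dots> = (\<Sum>l\<in>{1..K j}. ennreal (p j l) * emeasure (\<nu> j l) A)"
    proof (intro sum.cong refl)
      fix l assume l: "l \<in> {1..K j}"
      have "(\<Sum>k | k \<in> multi_indices K \<and> k j = l. ennreal (w k) * emeasure (\<nu> j (k j)) A)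
          = (\<Sum>k | k \<in> multi_indices K \<and> k j = l. ennreal (w k)) * emeasure (\<nu> j l) A"
        by (simp add: sum_distrib_right)
      also have "(\<Sum>k | k \<in> multi_indices K \<and> k j = l. ennreal (w k)) = ennreal (p j l)"
        using w l w0 by (subst sum_ennreal) (auto simp: discrete_couplings_def)
      finally show "(\<Sum>k | k \<in> multi_indices K \<and> k j = l. ennreal (w k) * emeasure (\<nu> j (k j)) A)
          = ennreal (p j l) * emeasure (\<nu> j l) A" .
    qed
    finally show "emeasure (distr (mixture (multi_indices K) w \<gamma>) borel (\<lambda>x. x $ j)) A
      = (\<Sum>l=1..K j. ennreal (p j l) * emeasure (\<nu> j l) A)" .
  qed (use \<nu> in auto)
  moreover have "prob_space (mixture (multi_indices K) w \<gamma>)"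
    using s w0 discrete_coupling_total[OF w p] by (intro prob_space_mixture) auto
  ultimately show ?thesis by (simp add: couplings_def)
qed

lemma mixture_in_GMM:
  assumes "finite I" "\<And>i. i \<in> I \<Longrightarrow> gaussian_measure (\<nu> i)" "\<And>i. i \<in> I \<Longrightarrow> 0 \<le> w i" "sum w I = 1"
  shows "mixture I w \<nu> \<in> GMM"
proof -
  obtain h where h: "bij_betw h {1..card I} I" using ex_bij_betw_nat_finite_1[OF assms(1)] by blast
  have hI: "h k \<in> I" if "k \<in> {1..card I}" for k using h that by (auto simp: bij_betw_def)
  have "sum (w \<circ> h) {1..card I} = 1"
    using sum.reindex_bij_betw[OF h, of w] assms(4) by simp
  moreover have "\<forall>k\<in>{1..card I}. (w \<circ> h) k \<ge> 0 \<and> gaussian_measure ((\<nu> \<circ> h) k)"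
    using assms hI by simp
  ultimately show ?thesis unfolding GMM_def using mixture_reindex[OF h, of w \<nu>] by blast
qed

lemma plan_cost_mixture:
  fixes \<gamma> :: "'i \<Rightarrow> ('a::euclidean_space ^ 'j::finite) measure"
  assumes "finite I" "\<And>i. i \<in> I \<Longrightarrow> sets (\<gamma> i) = sets borel"
  shows "plan_cost lam (mixture I w \<gamma>) = (\<Sum>i\<in>I. ennreal (w i) * plan_cost lam (\<gamma> i))"
  unfolding plan_cost_def using assms
  by (intro nn_integral_mixture) (auto simp: mm_cost_deviation)

text \<open>
  By identifiability, for every \<open>j\<close> the \<open>j\<close>-th marginal of a component \<open>N m\<close> of positive weight is one
  of the \<open>\<nu> j l\<close>, and the components with this marginal carry together the same mass as the indices \<open>l\<close>
  with this Gaussian. Several indices may share a Gaussian; the mass of \<open>N m\<close> is divided among them in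
  proportion to \<open>p j l\<close>, independently for the different \<open>j\<close>. Collecting the shares that belong to one
  multi-index \<open>k\<close> gives the weight \<open>w k\<close> and, after normalisation, a coupling of the \<open>\<nu> j (k j)\<close>. Where
  \<open>w k = 0\<close> there is nothing to normalise, and a coupling \<open>G k\<close> of choice is inserted.
\<close>

theorem GMM_coupling_decomposition:
  fixes \<nu> :: "'j::finite \<Rightarrow> nat \<Rightarrow> 'a::euclidean_space measure"
  assumes \<nu>: "\<And>j k. k \<in> {1..K j} \<Longrightarrow> gaussian_measure (\<nu> j k)"
    and p0: "\<And>j k. k \<in> {1..K j} \<Longrightarrow> 0 \<le> p j k" and p1: "\<And>j. (\<Sum>k=1..K j. p j k) = 1"
    and \<gamma>: "\<gamma> \<in> couplings (\<lambda>j. mixture {1..K j} (p j) (\<nu> j))" "\<gamma> \<in> GMM"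
    and G: "\<And>k. k \<in> multi_indices K \<Longrightarrow> G k \<in> couplings (\<lambda>j. \<nu> j (k j))"
  shows "\<exists>w\<in>discrete_couplings K p. \<exists>\<gamma>s.
    (\<forall>k\<in>multi_indices K. \<gamma>s k \<in> couplings (\<lambda>j. \<nu> j (k j)) \<and> (w k = 0 \<longrightarrow> \<gamma>s k = G k)) \<and>
    \<gamma> = mixture (multi_indices K) w \<gamma>s"
proof -
  obtain n q N where N: "\<And>m. m \<in> {1..n::nat} \<Longrightarrow> q m \<ge> 0 \<and> gaussian_measure (N m)"
    and q1: "(\<Sum>m=1..n. q m) = 1" and \<gamma>N: "\<gamma> = mixture {1..n} q N"
    using \<gamma>(2) unfolding GMM_def by blast
  define I where "I = {m\<in>{1..n}. q m \<noteq> 0}"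
  have I: "finite I" "\<And>m. m \<in> I \<Longrightarrow> q m > 0" "\<And>m. m \<in> I \<Longrightarrow> gaussian_measure (N m)"
    using N by (force simp: I_def)+
  have \<gamma>I: "\<gamma> = mixture I q N" unfolding \<gamma>N I_def by (rule mixture_drop_zero) simp
  have sN: "sets (N m) = sets borel" if "m \<in> I" for m using gaussian_sets[OF I(3)[OF that]] .
  define N' where "N' = (\<lambda>m j. distr (N m) borel (\<lambda>x. x $ j))"
  have N': "gaussian_measure (N' m j)" if "m \<in> I" for m j
    unfolding N'_def by (rule gaussian_distr_linear[OF I(3)[OF that]]) (auto intro: linearI)
  have marg: "mixture I q (\<lambda>m. N' m j) = mixture {1..K j} (p j) (\<nu> j)" for j
    using \<gamma>(1) sN unfolding N'_def
    by (subst distr_mixture[symmetric]) (auto simp: couplings_def \<gamma>I)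
  have ident: "(\<Sum>m | m \<in> I \<and> N' m j = H. q m) = (\<Sum>l | l \<in> {1..K j} \<and> \<nu> j l = H. p j l)" for j H
    using I N' \<nu> p0 marg by (intro gaussian_mixture_identifiable) (auto intro: less_imp_le)
  define D where "D = (\<lambda>j H. \<Sum>l | l \<in> {1..K j} \<and> \<nu> j l = H. p j l)"
  \<comment> \<open>\<open>a m j\<close> distributes the mass of \<open>N m\<close> over the indices \<open>l\<close> whose Gaussian is its \<open>j\<close>-th marginal;
    \<open>D j H\<close> is the total weight that the \<open>j\<close>-th mixture gives to the Gaussian \<open>H\<close>.\<close>
  define a where "a = (\<lambda>m j l. if \<nu> j l = N' m j then p j l / D j (N' m j) else 0)"
  have Dpos: "D j (N' m j) > 0" if m: "m \<in> I" for m j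
  proof -
    have "q m \<le> (\<Sum>m' | m' \<in> I \<and> N' m' j = N' m j. q m')"
      using I(1) I(2)[THEN less_imp_le] m by (intro member_le_sum) auto
    then show ?thesis using I(2)[OF m] ident[of j "N' m j"] by (simp add: D_def)
  qed
  have a0: "0 \<le> a m j l" if "m \<in> I" "l \<in> {1..K j}" for m j l
    using Dpos[OF that(1), of j] p0[OF that(2)] by (simp add: a_def)
  have a1: "(\<Sum>l=1..K j. a m j l) = 1" if m: "m \<in> I" for m j
  proof -
    have "(\<Sum>l=1..K j. a m j l) = (\<Sum>l | l \<in> {1..K j} \<and> \<nu> j l = N' m j. p j l / D j (N' m j))"
      unfolding a_def by (rule sum.inter_filter[symmetric]) simp
    also have "\<dots> = 1" using Dpos[OF m, of j] by (simp add: D_def flip: sum_divide_distrib)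
    finally show ?thesis .
  qed
  \<comment> \<open>Summed over \<open>m\<close>, the shares of \<open>l\<close> restore its weight, because by identifiability the total mass of the
    components \<open>N m\<close> with \<open>j\<close>-th marginal \<open>\<nu> j l\<close> is the denominator \<open>D j (\<nu> j l)\<close>.\<close>
  have aq: "(\<Sum>m\<in>I. q m * a m j l) = p j l" if l: "l \<in> {1..K j}" for j l
  proof -
    have "(\<Sum>m\<in>I. q m * a m j l) = (\<Sum>m\<in>I. if N' m j = \<nu> j l then q m * (p j l / D j (\<nu> j l)) else 0)"
      by (intro sum.cong) (auto simp: a_def)
    also have "\<dots> = (\<Sum>m | m \<in> I \<and> N' m j = \<nu> j l. q m * (p j l / D j (\<nu> j l)))"
      by (rule sum.inter_filter[OF I(1), symmetric])
    also have "\<dots> = (\<Sum>m | m \<in> I \<and> N' m j = \<nu> j l. q m) * (p j l / D j (\<nu> j l))"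
      by (rule sum_distrib_right[symmetric])
    also have "\<dots> = D j (\<nu> j l) * (p j l / D j (\<nu> j l))" by (simp add: ident D_def)
    also have "\<dots> = p j l"
    proof (cases "D j (\<nu> j l) = 0")
      case True
      have "p j l \<le> D j (\<nu> j l)"
        unfolding D_def using p0 l by (intro member_le_sum) auto
      then show ?thesis using True p0[OF l] by simp
    qed simp
    finally show ?thesis .
  qed
  define c where "c = (\<lambda>m k. q m * (\<Prod>j\<in>UNIV. a m j (k j)))"
  define w where "w = (\<lambda>k. \<Sum>m\<in>I. c m k)"
  have c0: "0 \<le> c m k" if "m \<in> I" "k \<in> multi_indices K" for m k
    unfolding c_def using I(2)[OF that(1)] a0[OF that(1)] multi_indices_mem[OF that(2)]
    by (intro mult_nonneg_nonneg prod_nonneg) auto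
  have w0: "0 \<le> w k" if "k \<in> multi_indices K" for k
    unfolding w_def using c0 that by (intro sum_nonneg)
  have wDC: "w \<in> discrete_couplings K p"
  proof -
    have "(\<Sum>k | k \<in> multi_indices K \<and> k j = l. w k) = p j l" if l: "l \<in> {1..K j}" for j l
    proof -
      have "(\<Sum>k | k \<in> multi_indices K \<and> k j = l. w k)
          = (\<Sum>m\<in>I. q m * (\<Sum>k | k \<in> multi_indices K \<and> k j = l. \<Prod>i\<in>UNIV. a m i (k i)))"
        unfolding w_def c_def by (subst sum.swap) (simp add: sum_distrib_left)
      also have "\<dots> = (\<Sum>m\<in>I. q m * a m j l)"
        using sum_multi_indices_prod_slice[of l K j "a _", OF l a1]
        by (intro sum.cong refl) simp
      finally show ?thesis using aq[OF l] by simp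
    qed
    then show ?thesis using w0 by (simp add: discrete_couplings_def)
  qed
  define \<gamma>s where "\<gamma>s = (\<lambda>k. if w k = 0 then G k else mixture I (\<lambda>m. c m k / w k) N)"
  have coup: "\<gamma>s k \<in> couplings (\<lambda>j. \<nu> j (k j))" if k: "k \<in> multi_indices K" for k
  proof (cases "w k = 0")
    case True
    then show ?thesis using G[OF k] by (simp add: \<gamma>s_def)
  next
    case False
    then have wk: "w k > 0" using w0[OF k] by simp
    have cw: "(\<Sum>m\<in>I. c m k / w k) = 1" using wk by (simp add: w_def flip: sum_divide_distrib)
    have cw0: "\<And>m. m \<in> I \<Longrightarrow> 0 \<le> c m k / w k" using c0[OF _ k] wk by simp
    have "distr (mixture I (\<lambda>m. c m k / w k) N) borel (\<lambda>x. x $ j) = \<nu> j (k j)" for j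
    proof -
      have "distr (mixture I (\<lambda>m. c m k / w k) N) borel (\<lambda>x. x $ j)
          = mixture I (\<lambda>m. c m k / w k) (\<lambda>m. N' m j)"
        unfolding N'_def using sN by (intro distr_mixture) auto
      also have "\<dots> = mixture I (\<lambda>m. c m k / w k) (\<lambda>_. \<nu> j (k j))"
      proof (rule mixture_cong[OF refl])
        fix m assume "c m k / w k \<noteq> 0"
        then have "(\<Prod>j\<in>UNIV. a m j (k j)) \<noteq> 0" by (simp add: c_def)
        then have "a m j (k j) \<noteq> 0" by (simp add: prod_zero_iff)
        then show "N' m j = \<nu> j (k j)" by (auto simp: a_def split: if_splits)
      qed
      also have "\<dots> = \<nu> j (k j)"
        using cw cw0 gaussian_sets[OF \<nu>[OF multi_indices_mem[OF k]]] by (intro mixture_const)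
      finally show ?thesis .
    qed
    moreover have "prob_space (mixture I (\<lambda>m. c m k / w k) N)"
      using sN I(3) cw cw0 by (intro prob_space_mixture) (auto simp: gaussian_prob)
    ultimately show ?thesis using False by (simp add: couplings_def \<gamma>s_def)
  qed
  have "\<gamma> = mixture (multi_indices K) w \<gamma>s"
  proof (rule mixture_eqI)
    fix A :: "('a ^ 'j) set" assume A: "A \<in> sets borel"
    have "(\<Sum>k\<in>multi_indices K. ennreal (w k) * emeasure (\<gamma>s k) A)
        = (\<Sum>k\<in>multi_indices K. \<Sum>m\<in>I. ennreal (c m k) * emeasure (N m) A)"
    proof (intro sum.cong refl)
      fix k assume k: "k \<in> multi_indices K"
      show "ennreal (w k) * emeasure (\<gamma>s k) A = (\<Sum>m\<in>I. ennreal (c m k) * emeasure (N m) A)"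
      proof (cases "w k = 0")
        case True
        then have "\<And>m. m \<in> I \<Longrightarrow> c m k = 0"
          using c0[OF _ k] I(1) by (simp add: w_def sum_nonneg_eq_0_iff)
        then show ?thesis using True by simp
      next
        case False
        have "ennreal (w k) * (\<Sum>m\<in>I. ennreal (c m k / w k) * emeasure (N m) A)
            = (\<Sum>m\<in>I. ennreal (w k * (c m k / w k)) * emeasure (N m) A)"
          unfolding sum_distrib_left ennreal_mult'[OF w0[OF k]] mult.assoc ..
        then show ?thesis using False A sN by (simp add: \<gamma>s_def emeasure_mixture)
      qed
    qed
    also have "\<dots> = (\<Sum>m\<in>I. \<Sum>k\<in>multi_indices K. ennreal (c m k) * emeasure (N m) A)"
      by (rule sum.swap)
    also have "\<dots> = (\<Sum>m\<in>I. ennreal (q m) * emeasure (N m) A)"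
    proof (intro sum.cong refl)
      fix m assume m: "m \<in> I"
      have "(\<Sum>k\<in>multi_indices K. c m k) = q m"
        using a1[OF m] by (simp add: c_def sum_multi_indices_prod flip: sum_distrib_left)
      then show "(\<Sum>k\<in>multi_indices K. ennreal (c m k) * emeasure (N m) A) = ennreal (q m) * emeasure (N m) A"
        using c0[OF m] by (simp flip: sum_distrib_right)
    qed
    also have "\<dots> = emeasure \<gamma> A" using A sN by (simp add: \<gamma>I emeasure_mixture)
    finally show "emeasure \<gamma> A = (\<Sum>k\<in>multi_indices K. ennreal (w k) * emeasure (\<gamma>s k) A)" ..
  qed (use coup in \<open>auto simp: \<gamma>I couplings_def\<close>)
  then show ?thesis using wDC coup by (intro bexI[of _ w] exI[of _ \<gamma>s]) (auto simp: \<gamma>s_def)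
qed

section \<open>Equality of the two problems\<close>

theorem proposition7:
  fixes \<mu> :: "'j::finite \<Rightarrow> (real ^ 'd::finite) measure"
    and K :: "'j \<Rightarrow> nat"
    and p :: "'j \<Rightarrow> nat \<Rightarrow> real"
    and \<nu> :: "'j \<Rightarrow> nat \<Rightarrow> (real ^ 'd) measure"
    and lam :: "'j \<Rightarrow> real"
  assumes "CARD('j) \<ge> 2"
    and "\<And>j k. k \<in> {1..K j} \<Longrightarrow> gaussian_measure (\<nu> j k)"
    and "\<And>j k. k \<in> {1..K j} \<Longrightarrow> p j k \<ge> 0"
    and "\<And>j. (\<Sum>k=1..K j. p j k) = 1"
    and "\<And>j. \<mu> j = mixture {1..K j} (p j) (\<nu> j)"
    and "\<And>j. lam j > 0"
    and "(\<Sum>j\<in>UNIV. lam j) = 1"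
  shows "(\<exists>w. discrete_solution lam K p \<nu> w \<and> MMW2_sq lam \<mu> = discrete_cost lam K \<nu> w) \<and>
    (\<exists>\<gamma>. optimal_GMM_plan lam \<mu> \<gamma>) \<and>
    (\<forall>\<gamma>. optimal_GMM_plan lam \<mu> \<gamma> \<longrightarrow>
      (\<exists>w \<gamma>s. discrete_solution lam K p \<nu> w \<and>
        (\<forall>k\<in>multi_indices K. optimal_mm_plan lam (\<lambda>j. \<nu> j (k j)) (\<gamma>s k)) \<and>
        \<gamma> = mixture (multi_indices K) w \<gamma>s))"
proof -
  note \<nu> = assms(2) and p0 = assms(3) and p1 = assms(4)
  have \<mu>: "\<mu> = (\<lambda>j. mixture {1..K j} (p j) (\<nu> j))" using assms(5) by auto
  let ?I = "multi_indices K"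
  let ?W = "\<lambda>k. mmW2_sq lam (\<lambda>j. \<nu> j (k j))"
  have "\<forall>k\<in>?I. \<exists>\<gamma>. gaussian_measure \<gamma> \<and> optimal_mm_plan lam (\<lambda>j. \<nu> j (k j)) \<gamma> \<and> plan_cost lam \<gamma> < \<infinity>"
    using assms(6) by (intro ballI optimal_gaussian_plan_exists \<nu> multi_indices_mem) (simp_all add: less_imp_le)
  then obtain G where G: "\<And>k. k \<in> ?I \<Longrightarrow> gaussian_measure (G k)"
    and Gopt: "\<And>k. k \<in> ?I \<Longrightarrow> optimal_mm_plan lam (\<lambda>j. \<nu> j (k j)) (G k)"
    and Gfin: "\<And>k. k \<in> ?I \<Longrightarrow> plan_cost lam (G k) < \<infinity>"
    by metis
  have Gc: "G k \<in> couplings (\<lambda>j. \<nu> j (k j))" and Gcost: "plan_cost lam (G k) = ?W k" if "k \<in> ?I" for k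
    using Gopt[OF that] by (auto simp: optimal_mm_plan_def)
  have Wfin: "?W k < \<infinity>" if "k \<in> ?I" for k using Gfin[OF that] Gcost[OF that] by simp
  obtain w where w: "discrete_solution lam K p \<nu> w"
    using discrete_solution_exists[where K = K and p = p and lam = lam and \<nu> = \<nu>, OF p0 p1 Wfin] by blast
  then have wD: "w \<in> discrete_couplings K p"
    and wmin: "\<And>v. v \<in> discrete_couplings K p \<Longrightarrow> discrete_cost lam K \<nu> w \<le> discrete_cost lam K \<nu> v"
    by (auto simp: discrete_solution_def is_arg_min_def not_less)
  \<comment> \<open>Every admissible plan costs at least as much as the discrete coupling extracted from it.\<close>
  have lower: "\<exists>v\<in>discrete_couplings K p. \<exists>\<gamma>s.
      (\<forall>k\<in>?I. \<gamma>s k \<in> couplings (\<lambda>j. \<nu> j (k j)) \<and> (v k = 0 \<longrightarrow> \<gamma>s k = G k)) \<and>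
      \<gamma> = mixture ?I v \<gamma>s \<and> plan_cost lam \<gamma> = (\<Sum>k\<in>?I. ennreal (v k) * plan_cost lam (\<gamma>s k)) \<and>
      discrete_cost lam K \<nu> v \<le> plan_cost lam \<gamma>"
    if \<gamma>: "\<gamma> \<in> couplings \<mu> \<inter> GMM" for \<gamma>
  proof -
    have dec: "\<exists>v\<in>discrete_couplings K p. \<exists>\<gamma>s.
        (\<forall>k\<in>?I. \<gamma>s k \<in> couplings (\<lambda>j. \<nu> j (k j)) \<and> (v k = 0 \<longrightarrow> \<gamma>s k = G k)) \<and>
        \<gamma> = mixture ?I v \<gamma>s"
      by (rule GMM_coupling_decomposition[OF \<nu> p0 p1 _ _ Gc]) (use \<gamma> in \<open>simp_all add: \<mu>\<close>)
    obtain v \<gamma>s where v: "v \<in> discrete_couplings K p"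
      and \<gamma>s: "\<And>k. k \<in> ?I \<Longrightarrow> \<gamma>s k \<in> couplings (\<lambda>j. \<nu> j (k j)) \<and> (v k = 0 \<longrightarrow> \<gamma>s k = G k)"
      and eq: "\<gamma> = mixture ?I v \<gamma>s"
      using dec by blast
    have cost: "plan_cost lam \<gamma> = (\<Sum>k\<in>?I. ennreal (v k) * plan_cost lam (\<gamma>s k))"
      unfolding eq using \<gamma>s by (intro plan_cost_mixture) (auto simp: couplings_def)
    have "discrete_cost lam K \<nu> v \<le> plan_cost lam \<gamma>"
      unfolding cost discrete_cost_def mmW2_sq_def
      using \<gamma>s by (intro sum_mono mult_left_mono INF_lower) auto
    then show ?thesis using v \<gamma>s eq cost by blast
  qed
  let ?\<gamma> = "mixture ?I w G"
  have wsum: "sum w ?I = 1" and w0: "\<And>k. k \<in> ?I \<Longrightarrow> 0 \<le> w k"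
    using discrete_coupling_total[OF wD p1] wD by (auto simp: discrete_couplings_def)
  have "?\<gamma> \<in> couplings \<mu>"
    unfolding \<mu> using wD p1 Gc gaussian_sets[OF \<nu>] by (intro mixture_of_couplings) auto
  then have feas: "?\<gamma> \<in> couplings \<mu> \<inter> GMM"
    using mixture_in_GMM[of ?I G w] G w0 wsum by simp
  have cost: "plan_cost lam ?\<gamma> = discrete_cost lam K \<nu> w"
    using G gaussian_sets by (subst plan_cost_mixture) (auto simp: discrete_cost_def Gcost)
  have val: "MMW2_sq lam \<mu> = discrete_cost lam K \<nu> w"
  proof (rule antisym)
    show "MMW2_sq lam \<mu> \<le> discrete_cost lam K \<nu> w"
      unfolding MMW2_sq_def cost[symmetric] using feas by (rule INF_lower)
    show "discrete_cost lam K \<nu> w \<le> MMW2_sq lam \<mu>"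
      unfolding MMW2_sq_def
    proof (rule INF_greatest)
      fix \<gamma> assume "\<gamma> \<in> couplings \<mu> \<inter> GMM"
      from lower[OF this] show "discrete_cost lam K \<nu> w \<le> plan_cost lam \<gamma>"
        using wmin order.trans by blast
    qed
  qed
  have wfin: "discrete_cost lam K \<nu> w < \<infinity>"
    unfolding discrete_cost_def using Wfin by (simp add: ennreal_mult_less_top)
  have struct: "\<exists>v \<gamma>s. discrete_solution lam K p \<nu> v \<and>
        (\<forall>k\<in>?I. optimal_mm_plan lam (\<lambda>j. \<nu> j (k j)) (\<gamma>s k)) \<and> \<gamma> = mixture ?I v \<gamma>s"
    if opt: "optimal_GMM_plan lam \<mu> \<gamma>" for \<gamma>
  proof -
    have \<gamma>: "\<gamma> \<in> couplings \<mu> \<inter> GMM" and \<gamma>cost: "plan_cost lam \<gamma> = discrete_cost lam K \<nu> w"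
      using opt val by (auto simp: optimal_GMM_plan_def)
    obtain v \<gamma>s where v: "v \<in> discrete_couplings K p"
      and \<gamma>s: "\<And>k. k \<in> ?I \<Longrightarrow> \<gamma>s k \<in> couplings (\<lambda>j. \<nu> j (k j))" "\<And>k. k \<in> ?I \<Longrightarrow> v k = 0 \<Longrightarrow> \<gamma>s k = G k"
      and eq: "\<gamma> = mixture ?I v \<gamma>s"
      and sumc: "plan_cost lam \<gamma> = (\<Sum>k\<in>?I. ennreal (v k) * plan_cost lam (\<gamma>s k))"
      and le: "discrete_cost lam K \<nu> v \<le> plan_cost lam \<gamma>"
      using lower[OF \<gamma>] by blast
    have v0: "\<And>k. k \<in> ?I \<Longrightarrow> 0 \<le> v k" using v by (simp add: discrete_couplings_def)
    have veq: "discrete_cost lam K \<nu> v = discrete_cost lam K \<nu> w"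
      using le \<gamma>cost wmin[OF v] by simp
    then have sol: "discrete_solution lam K p \<nu> v"
      using w v by (simp add: discrete_solution_def is_arg_min_def)
    have "optimal_mm_plan lam (\<lambda>j. \<nu> j (k j)) (\<gamma>s k)" if k: "k \<in> ?I" for k
    proof (cases "v k = 0")
      case True
      then show ?thesis using \<gamma>s(2)[OF k] Gopt[OF k] by simp
    next
      case False
      let ?t = "\<lambda>k. ennreal (v k) * plan_cost lam (\<gamma>s k)" and ?u = "\<lambda>k. ennreal (v k) * ?W k"
      have ut: "?u i \<le> ?t i" if "i \<in> ?I" for i
        unfolding mmW2_sq_def using \<gamma>s(1)[OF that] by (intro mult_left_mono INF_lower) auto
      have tot: "sum ?t ?I = sum ?u ?I" using veq sumc \<gamma>cost by (simp add: discrete_cost_def)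
      have fin: "sum ?u ?I < \<infinity>" using veq wfin by (simp add: discrete_cost_def)
      \<comment> \<open>The sums agree and are finite, so the termwise inequality cannot be strict anywhere.\<close>
      have "?t k = ?u k"
      proof (rule ccontr)
        assume "?t k \<noteq> ?u k"
        then have lt: "?u k < ?t k" using ut[OF k] by simp
        have rest: "sum ?u (?I - {k}) \<le> sum ?t (?I - {k})" using ut by (intro sum_mono) auto
        have "sum ?u (?I - {k}) < \<infinity>"
          using fin sum_mono2[of ?I "?I - {k}" ?u] by (auto intro: le_less_trans)
        then have "sum ?u (?I - {k}) + ?u k < sum ?u (?I - {k}) + ?t k"
          using lt unfolding ennreal_add_left_cancel_less by (auto simp only: less_top infinity_ennreal_def)
        also have "\<dots> \<le> sum ?t (?I - {k}) + ?t k" using rest by (rule add_right_mono)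
        finally show False using tot k by (simp add: sum.remove[of ?I k] add.commute)
      qed
      then have "plan_cost lam (\<gamma>s k) = ?W k"
        using False v0[OF k] by (simp add: ennreal_mult_cancel_left)
      then show ?thesis using \<gamma>s(1)[OF k] by (simp add: optimal_mm_plan_def)
    qed
    then show ?thesis using sol eq by blast
  qed
  have "optimal_GMM_plan lam \<mu> ?\<gamma>" using feas cost val by (simp add: optimal_GMM_plan_def)
  then show ?thesis using w val struct by blast
qed

end
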